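(* Let $G$ and $G'$ be abelian groups and consider the $G$-graded algebra $R=\mathrm{End}_D(V)$ and the $G'$-graded algebra $R'=\mathrm{End}_{D'}(V')$, where $D$ and $D'$ are graded-division algebras over a field $\mathbb F$ (graded by $G$ and $G'$, respectively) and $V$ and $V'$ are nonzero graded right modules of finite rank over $D$ and $D'$, respectively. (1) If $\psi:R\to R'$ is an equivalence of graded algebras, then there exists an equivalence $(\psi_0,\psi_1)$ from $(D,V)$ to $(D',V')$, by which we mean that (i) $\psi_0:D\to D'$ is an equivalence of graded algebras, (ii) $\psi_1:V\to V'$ is an equivalence of graded vector spaces, and (iii) $\psi_1(vd)=\psi_1(v)\psi_0(d)$ for all $v\in V$ and $d\in D$, such that $\psi(r)=\psi_1r\psi_1^{-1}$ for all $r\in R$. (2) Another pair $(\psi_0',\psi_1')$ satisfies these conditions if and only if there exists $d'\in D'^\times_{\mathrm{gr}}$ such that $\psi_0'=\mathrm{Int}(d')^{-1}\circ\psi_0$ and $\psi_1'(v)=\psi_1(v)d'$ for all $v\in V$. (3) Suppose $\varphi$ and $\varphi'$ are degree-preserving antiautomorphisms of $R$ and $R'$, respectively, and let $(\varphi_0,B)$ and $(\varphi_0',B')$ be pairs representing them (as described in the context). Then $\psi$ satisfies $\psi\varphi\psi^{-1}=\varphi'$ if and only if there exists $d_0\in D^\times_{\mathrm{gr}}$ such that $$B'(\psi_1(v),\psi_1(w))=\psi_0(d_0B(v,w))\quad\text{for all }v,w\in V.$$ If this is the case, we also have $\mathrm{Int}(d_0)\circ\varphi_0=\psi_0^{-1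}\varphi_0'\psi_0$.
   Context: All algebras are associative over an arbitrary field $\mathbb F$. A graded-division algebra is a unital graded algebra in which all nonzero homogeneous elements are invertible; $D^\times_{\mathrm{gr}}$ is the group of nonzero homogeneous elements and $\mathrm{Int}(d)(x)=dxd^{-1}$. $R=\mathrm{End}_D(V)$ is graded by $R_g=\{r\in R\mid rV_h\subset V_{gh}\ \forall h\in G\}$, and similarly $R'$. An equivalence of graded algebras (resp. graded vector spaces) is an algebra isomorphism (resp. linear isomorphism) mapping each nonzero homogeneous component onto a homogeneous component. A pair $(\varphi_0,B)$ represents a degree-preserving antiautomorphism $\varphi$ of $R$ (i.e., an $\mathbb F$-linear antiautomorphism mapping each homogeneous component to itself) if $\varphi_0$ is a degree-preserving antiautomorphism of $D$ and $B:V\times V\to D$ is a nondegenerate $\mathbb F$-bilinear map such that $B(vd,w)=\varphi_0(d)B(v,w)$, $B(v,wd)=B(v,w)d$; for some $g_0\in G$, $B(V_a,V_b)\subset D_{g_0ab}$ for all $a,b\in G$; and $B(rv,w)=B(v,\varphi(r)w)$ for all $r\in R$, $v,w\in V$. Such pairs always exist. Similarly for $\varphi'$. *)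

theory Defs
  imports Complex_Main "HOL-Library.Function_Algebras"
begin

text \<open>
  Grading groups are types of class \<^class>\<open>ab_group_add\<close>, hence written additively: the product
  $gh$ of the usual multiplicative notation is \<open>g + h\<close> and the identity $e$ is \<open>0\<close>.
  A grading is the family of its homogeneous components, indexed by all of the group.
\<close>

locale graded_vector_space = vector_space scale
  for scale :: "'f::field \<Rightarrow> 'v::ab_group_add \<Rightarrow> 'v"
    and component :: "'g::ab_group_add \<Rightarrow> 'v set" +
  assumes subspace_comp: "subspace (component g)"
    and direct_sum: "\<exists>!c. finite {g. c g \<noteq> 0} \<and> (\<forall>g. c g \<in> component g) \<and> x = (\<Sum>g | c g \<noteq> 0. c g)"

locale graded_algebra = graded_vector_space scale component
  for scale :: "'f::field \<Rightarrow> 'd::ring_1 \<Rightarrow> 'd"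
    and component :: "'g::ab_group_add \<Rightarrow> 'd set" +
  assumes scale_mult_left: "scale a x * y = scale a (x * y)"
    and scale_mult_right: "x * scale a y = scale a (x * y)"
    and mult_comp: "x \<in> component g \<Longrightarrow> y \<in> component h \<Longrightarrow> x * y \<in> component (g + h)"

locale graded_division_algebra = graded_algebra +
  assumes homogeneous_invertible: "x \<in> component g \<Longrightarrow> x \<noteq> 0 \<Longrightarrow> \<exists>y. x * y = 1 \<and> y * x = 1"

definition homogeneous_units :: "('g \<Rightarrow> 'd::zero set) \<Rightarrow> 'd set" where
  "homogeneous_units component = (\<Union>g. component g) - {0}"

definition ring_inverse :: "'d::ring_1 \<Rightarrow> 'd" where
  "ring_inverse d = (THE e. d * e = 1 \<and> e * d = 1)"

definition inner_aut :: "'d::ring_1 \<Rightarrow> 'd \<Rightarrow> 'd" where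
  "inner_aut d x = d * x * ring_inverse d"

text \<open>A right \<open>D\<close>-module is a vector space over the ground field via $av = v(a1)$.\<close>

definition induced_scale :: "('f \<Rightarrow> 'd::ring_1 \<Rightarrow> 'd) \<Rightarrow> ('v \<Rightarrow> 'd \<Rightarrow> 'v) \<Rightarrow> 'f \<Rightarrow> 'v \<Rightarrow> 'v" where
  "induced_scale scale act a v = act v (scale a 1)"

locale graded_right_module = D: graded_algebra scale Dg + graded_vector_space "induced_scale scale act" Vg
  for scale :: "'f::field \<Rightarrow> 'd::ring_1 \<Rightarrow> 'd"
    and Dg :: "'g::ab_group_add \<Rightarrow> 'd set"
    and act :: "'v::ab_group_add \<Rightarrow> 'd \<Rightarrow> 'v"
    and Vg :: "'g \<Rightarrow> 'v set" +
  assumes act_add_left: "act (v + w) d = act v d + act w d"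
    and act_add_right: "act v (d + e) = act v d + act v e"
    and act_mult: "act v (d * e) = act (act v d) e"
    and act_one: "act v 1 = v"
    and act_comp: "v \<in> Vg h \<Longrightarrow> d \<in> Dg g \<Longrightarrow> act v d \<in> Vg (h + g)"

text \<open>
  Free with a finite basis. The basis is not required to be homogeneous; over a graded-division
  algebra every graded module has a homogeneous basis, so this agrees with the graded notion.
\<close>

definition finite_rank :: "('v::ab_group_add \<Rightarrow> 'd::ring_1 \<Rightarrow> 'v) \<Rightarrow> bool" where
  "finite_rank act \<longleftrightarrow>
    (\<exists>E. finite E \<and> (\<forall>v. \<exists>!c. (\<forall>b. b \<notin> E \<longrightarrow> c b = 0) \<and> v = (\<Sum>b\<in>E. act b (c b))))"

text \<open>
  The algebra $\mathrm{End}_D(V)$ is a set of functions with pointwise addition (from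
  \<^theory>\<open>HOL-Library.Function_Algebras\<close>), multiplication \<open>(\<circ>)\<close>, and scalar
  multiplication \<open>End_scale\<close>; the pointwise product of functions is never used.
\<close>

definition End_D :: "('v::ab_group_add \<Rightarrow> 'd \<Rightarrow> 'v) \<Rightarrow> ('v \<Rightarrow> 'v) set" where
  "End_D act = {r. (\<forall>v w. r (v + w) = r v + r w) \<and> (\<forall>v d. r (act v d) = act (r v) d)}"

definition End_comp ::
    "('v::ab_group_add \<Rightarrow> 'd \<Rightarrow> 'v) \<Rightarrow> ('g::ab_group_add \<Rightarrow> 'v set) \<Rightarrow> 'g \<Rightarrow> ('v \<Rightarrow> 'v) set" where
  "End_comp act Vg g = {r \<in> End_D act. \<forall>h. r ` Vg h \<subseteq> Vg (g + h)}"

definition End_scale ::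
    "('f \<Rightarrow> 'd::ring_1 \<Rightarrow> 'd) \<Rightarrow> ('v \<Rightarrow> 'd \<Rightarrow> 'v) \<Rightarrow> 'f \<Rightarrow> ('v \<Rightarrow> 'v) \<Rightarrow> ('v \<Rightarrow> 'v)" where
  "End_scale scale act a r = (\<lambda>v. induced_scale scale act a (r v))"

text \<open>
  Maps between graded structures take the carriers, scalar multiplications, products and
  components as arguments, so that they apply to $D$ and $V$ (carrier \<^term>\<open>UNIV\<close>) as well as
  to $\mathrm{End}_D(V)$.
\<close>

definition linear_bij ::
    "'a::ab_group_add set \<Rightarrow> ('f \<Rightarrow> 'a \<Rightarrow> 'a) \<Rightarrow> 'b::ab_group_add set \<Rightarrow> ('f \<Rightarrow> 'b \<Rightarrow> 'b) \<Rightarrow> ('a \<Rightarrow> 'b) \<Rightarrow> bool" where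
  "linear_bij A sA B sB f \<longleftrightarrow>
    bij_betw f A B \<and>
    (\<forall>x\<in>A. \<forall>y\<in>A. f (x + y) = f x + f y) \<and>
    (\<forall>a. \<forall>x\<in>A. f (sA a x) = sB a (f x))"

definition graded_space_equivalence ::
    "'a::ab_group_add set \<Rightarrow> ('f \<Rightarrow> 'a \<Rightarrow> 'a) \<Rightarrow> ('g \<Rightarrow> 'a set) \<Rightarrow>
     'b::ab_group_add set \<Rightarrow> ('f \<Rightarrow> 'b \<Rightarrow> 'b) \<Rightarrow> ('h \<Rightarrow> 'b set) \<Rightarrow> ('a \<Rightarrow> 'b) \<Rightarrow> bool" where
  "graded_space_equivalence A sA Ag B sB Bg f \<longleftrightarrow>
    linear_bij A sA B sB f \<and>
    (\<forall>g. Ag g \<noteq> {0} \<longrightarrow> (\<exists>h. f ` Ag g = Bg h))"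

definition graded_algebra_equivalence ::
    "'a::ab_group_add set \<Rightarrow> ('a \<Rightarrow> 'a \<Rightarrow> 'a) \<Rightarrow> ('f \<Rightarrow> 'a \<Rightarrow> 'a) \<Rightarrow> ('g \<Rightarrow> 'a set) \<Rightarrow>
     'b::ab_group_add set \<Rightarrow> ('b \<Rightarrow> 'b \<Rightarrow> 'b) \<Rightarrow> ('f \<Rightarrow> 'b \<Rightarrow> 'b) \<Rightarrow> ('h \<Rightarrow> 'b set) \<Rightarrow> ('a \<Rightarrow> 'b) \<Rightarrow> bool" where
  "graded_algebra_equivalence A mA sA Ag B mB sB Bg f \<longleftrightarrow>
    graded_space_equivalence A sA Ag B sB Bg f \<and>
    (\<forall>x\<in>A. \<forall>y\<in>A. f (mA x y) = mB (f x) (f y))"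

definition degree_preserving_antiautomorphism ::
    "'a::ab_group_add set \<Rightarrow> ('a \<Rightarrow> 'a \<Rightarrow> 'a) \<Rightarrow> ('f \<Rightarrow> 'a \<Rightarrow> 'a) \<Rightarrow> ('g \<Rightarrow> 'a set) \<Rightarrow> ('a \<Rightarrow> 'a) \<Rightarrow> bool" where
  "degree_preserving_antiautomorphism A mA sA Ag f \<longleftrightarrow>
    linear_bij A sA A sA f \<and>
    (\<forall>x\<in>A. \<forall>y\<in>A. f (mA x y) = mA (f y) (f x)) \<and>
    (\<forall>g. f ` Ag g \<subseteq> Ag g)"

definition graded_pair_equivalence ::
    "('f::field \<Rightarrow> 'd::ring_1 \<Rightarrow> 'd) \<Rightarrow> ('g \<Rightarrow> 'd set) \<Rightarrow>
     ('v::ab_group_add \<Rightarrow> 'd \<Rightarrow> 'v) \<Rightarrow> ('g \<Rightarrow> 'v set) \<Rightarrow>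
     ('f \<Rightarrow> 'e::ring_1 \<Rightarrow> 'e) \<Rightarrow> ('h \<Rightarrow> 'e set) \<Rightarrow>
     ('w::ab_group_add \<Rightarrow> 'e \<Rightarrow> 'w) \<Rightarrow> ('h \<Rightarrow> 'w set) \<Rightarrow>
     ('d \<Rightarrow> 'e) \<Rightarrow> ('v \<Rightarrow> 'w) \<Rightarrow> bool" where
  "graded_pair_equivalence sD Dg act Vg sD' Dg' act' Vg' \<psi>0 \<psi>1 \<longleftrightarrow>
    graded_algebra_equivalence UNIV (*) sD Dg UNIV (*) sD' Dg' \<psi>0 \<and>
    graded_space_equivalence UNIV (induced_scale sD act) Vg UNIV (induced_scale sD' act') Vg' \<psi>1 \<and>
    (\<forall>v d. \<psi>1 (act v d) = act' (\<psi>1 v) (\<psi>0 d))"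

definition induces ::
    "('f::field \<Rightarrow> 'd::ring_1 \<Rightarrow> 'd) \<Rightarrow> ('g \<Rightarrow> 'd set) \<Rightarrow>
     ('v::ab_group_add \<Rightarrow> 'd \<Rightarrow> 'v) \<Rightarrow> ('g \<Rightarrow> 'v set) \<Rightarrow>
     ('f \<Rightarrow> 'e::ring_1 \<Rightarrow> 'e) \<Rightarrow> ('h \<Rightarrow> 'e set) \<Rightarrow>
     ('w::ab_group_add \<Rightarrow> 'e \<Rightarrow> 'w) \<Rightarrow> ('h \<Rightarrow> 'w set) \<Rightarrow>
     ('d \<Rightarrow> 'e) \<Rightarrow> ('v \<Rightarrow> 'w) \<Rightarrow> (('v \<Rightarrow> 'v) \<Rightarrow> ('w \<Rightarrow> 'w)) \<Rightarrow> bool" where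
  "induces sD Dg act Vg sD' Dg' act' Vg' \<psi>0 \<psi>1 \<psi> \<longleftrightarrow>
    graded_pair_equivalence sD Dg act Vg sD' Dg' act' Vg' \<psi>0 \<psi>1 \<and>
    (\<forall>r\<in>End_D act. \<psi> r = \<psi>1 \<circ> r \<circ> inv \<psi>1)"

definition bilinear_over :: "('f::field \<Rightarrow> 'v::ab_group_add \<Rightarrow> 'v) \<Rightarrow> ('f \<Rightarrow> 'd::ab_group_add \<Rightarrow> 'd) \<Rightarrow>
    ('v \<Rightarrow> 'v \<Rightarrow> 'd) \<Rightarrow> bool" where
  "bilinear_over sV sD B \<longleftrightarrow>
    (\<forall>v. Vector_Spaces.linear sV sD (B v)) \<and> (\<forall>w. Vector_Spaces.linear sV sD (\<lambda>v. B v w))"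

definition nondegenerate :: "('v::zero \<Rightarrow> 'v \<Rightarrow> 'd::zero) \<Rightarrow> bool" where
  "nondegenerate B \<longleftrightarrow>
    (\<forall>v. (\<forall>w. B v w = 0) \<longrightarrow> v = 0) \<and> (\<forall>w. (\<forall>v. B v w = 0) \<longrightarrow> w = 0)"

definition represents ::
    "('f::field \<Rightarrow> 'd::ring_1 \<Rightarrow> 'd) \<Rightarrow> ('g::ab_group_add \<Rightarrow> 'd set) \<Rightarrow>
     ('v::ab_group_add \<Rightarrow> 'd \<Rightarrow> 'v) \<Rightarrow> ('g \<Rightarrow> 'v set) \<Rightarrow>
     ('d \<Rightarrow> 'd) \<Rightarrow> ('v \<Rightarrow> 'v \<Rightarrow> 'd) \<Rightarrow> (('v \<Rightarrow> 'v) \<Rightarrow> ('v \<Rightarrow> 'v)) \<Rightarrow> bool" where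
  "represents sD Dg act Vg \<phi>0 B \<phi> \<longleftrightarrow>
    degree_preserving_antiautomorphism UNIV (*) sD Dg \<phi>0 \<and>
    bilinear_over (induced_scale sD act) sD B \<and>
    nondegenerate B \<and>
    (\<forall>v w d. B (act v d) w = \<phi>0 d * B v w) \<and>
    (\<forall>v w d. B v (act w d) = B v w * d) \<and>
    (\<exists>g0. \<forall>a b. \<forall>v\<in>Vg a. \<forall>w\<in>Vg b. B v w \<in> Dg (g0 + a + b)) \<and>
    (\<forall>r\<in>End_D act. \<forall>v w. B (r v) w = B v (\<phi> r w))"

end

theory Submission
  imports Defs
begin

text \<open>
  Every nonzero homogeneous $w \in V$ has a dual homogeneous $D$-linear functional $\lambda$ with
  $\lambda(w) = 1$; it is the projection along a graded submodule that is maximal among those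
  avoiding $w$. The rank one operators $v\lambda(\cdot)$ then carry the whole argument. They show
  that additive maps commuting with $R$ are right multiplications by elements of $D$, which gives
  $\psi_0$ and the uniqueness in (2). If $\epsilon = v\lambda(\cdot)$ is an idempotent with
  $v$ homogeneous, then all nonzero homogeneous elements of $\epsilon R\epsilon \cong D$ are
  invertible, hence $\psi(\epsilon)V' = wD'$ for a homogeneous $w$, and
  $\psi_1(u) = \psi(u\lambda(\cdot))w$ works. For (3), $B$ and
  $C(v,w) = \psi_0^{-1}(B'(\psi_1(v),\psi_1(w)))$ have the same adjoint operation; with $v$
  chosen such that $B(v,\cdot) = \lambda$, applying adjoints of rank one operators yields
  $C = C(v,w)B$.
\<close>

section \<open>Homogeneous components\<close>

text \<open>The family of all components is described first and then evaluated at \<open>g\<close>,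
  because the direct sum axiom asserts uniqueness of the family and not of its single
  members.\<close>

definition hproj :: "('g::ab_group_add \<Rightarrow> 'v::ab_group_add set) \<Rightarrow> 'g \<Rightarrow> 'v \<Rightarrow> 'v" where
  "hproj component g x =
    (THE c. finite {g. c g \<noteq> 0} \<and> (\<forall>g. c g \<in> component g) \<and> x = (\<Sum>g | c g \<noteq> 0. c g)) g"

context graded_vector_space
begin

lemma hproj_decomposition:
  "finite {g. hproj component g x \<noteq> 0} \<and> (\<forall>g. hproj component g x \<in> component g) \<and>
    x = (\<Sum>g | hproj component g x \<noteq> 0. hproj component g x)"
  using theI'[OF direct_sum[of x]] unfolding hproj_def by simp

lemma finite_hproj: "finite {g. hproj component g x \<noteq> 0}"
  and hproj_in: "hproj component g x \<in> component g"
  and sum_hproj: "(\<Sum>g | hproj component g x \<noteq> 0. hproj component g x) = x"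
  using hproj_decomposition[of x] by simp_all

text \<open>The finite set \<open>S\<close> need only contain the support of \<open>c\<close>. This
  makes sums of two elements accessible, where the union of the supports may exceed the support of
  the sum.\<close>

lemma hproj_unique:
  assumes "finite S" "\<And>g. c g \<in> component g" "\<And>g. g \<notin> S \<Longrightarrow> c g = 0" "x = (\<Sum>g\<in>S. c g)"
  shows "hproj component g x = c g"
proof -
  have sub: "{g. c g \<noteq> 0} \<subseteq> S" using assms(3) by auto
  have "finite {g. c g \<noteq> 0}" using finite_subset[OF sub assms(1)] .
  moreover have "x = (\<Sum>g | c g \<noteq> 0. c g)"
    unfolding assms(4) by (rule sum.mono_neutral_right[OF assms(1) sub]) auto
  ultimately show ?thesis
    unfolding hproj_def using assms(2) by (subst the1_equality[OF direct_sum, of c]) auto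
qed

lemma zero_in [simp]: "0 \<in> component g"
  using subspace_comp subspace_0 by blast

lemma add_in: "x \<in> component g \<Longrightarrow> y \<in> component g \<Longrightarrow> x + y \<in> component g"
  using subspace_comp subspace_add by blast

lemma hproj_homogeneous:
  assumes "x \<in> component g"
  shows "hproj component h x = (if h = g then x else 0)"
  by (rule hproj_unique[of "{g}"]) (use assms in auto)

lemma hproj_zero [simp]: "hproj component h 0 = 0"
  using hproj_homogeneous[OF zero_in] by simp

lemma hproj_add: "hproj component g (x + y) = hproj component g x + hproj component g y"
proof (rule hproj_unique[of "{g. hproj component g x \<noteq> 0} \<union> {g. hproj component g y \<noteq> 0}"])
  let ?S = "{g. hproj component g x \<noteq> 0} \<union> {g. hproj component g y \<noteq> 0}"
  have S: "finite ?S" using finite_hproj by simp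
  have "x = (\<Sum>g\<in>?S. hproj component g x)"
    by (rule trans[OF sum_hproj[symmetric] sum.mono_neutral_left[OF S]]) auto
  moreover have "y = (\<Sum>g\<in>?S. hproj component g y)"
    by (rule trans[OF sum_hproj[symmetric] sum.mono_neutral_left[OF S]]) auto
  ultimately show "x + y = (\<Sum>g\<in>?S. hproj component g x + hproj component g y)"
    by (simp add: sum.distrib)
qed (use finite_hproj hproj_in add_in in auto)

text \<open>Every element is the finite sum of its components, with the empty sum covered by the
  homogeneous element 0. Additive identities thereby reduce to homogeneous arguments.\<close>

lemma homogeneous_induct [case_names homogeneous add]:
  assumes "\<And>g x. x \<in> component g \<Longrightarrow> P x" "\<And>x y. P x \<Longrightarrow> P y \<Longrightarrow> P (x + y)"
  shows "P x"
proof -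
  have "P (\<Sum>g\<in>S. hproj component g x)" if "finite S" for S
    using that
  proof induction
    case empty
    then show ?case using assms(1)[OF zero_in] by simp
  next
    case (insert g S)
    then show ?case using assms(2) assms(1)[OF hproj_in[of g x]] by simp
  qed
  then show ?thesis using finite_hproj sum_hproj by metis
qed

lemma hproj_nonzero: "x \<noteq> 0 \<Longrightarrow> \<exists>g. hproj component g x \<noteq> 0"
  using sum_hproj[of x] by (metis (mono_tags, lifting) sum.neutral)

lemma degree_unique: "x \<in> component g \<Longrightarrow> x \<in> component h \<Longrightarrow> x \<noteq> 0 \<Longrightarrow> g = h"
  using hproj_homogeneous by metis

end

section \<open>Additive maps between graded spaces\<close>

text \<open>Both sides are additive in \<open>x\<close>, so homogeneous \<open>x\<close> suffice.
  With the shift \<open>k\<close> this covers multiplication by a homogeneous element on either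
  side, the action on a homogeneous vector, and a form with one homogeneous argument fixed.\<close>

lemma hproj_graded_map:
  assumes "graded_vector_space s A" "graded_vector_space t B"
    and add: "\<And>x y. f (x + y) = f x + f y"
    and shift: "\<And>g x. x \<in> A g \<Longrightarrow> f x \<in> B (g + k)"
  shows "hproj B (g + k) (f x) = f (hproj A g x)"
proof -
  interpret A: graded_vector_space s A by fact
  interpret B: graded_vector_space t B by fact
  have f0: "f 0 = 0" using add[of 0 0] by simp
  show ?thesis
  proof (induction x rule: A.homogeneous_induct)
    case (homogeneous h x)
    then show ?case
      using B.hproj_homogeneous[OF shift[OF homogeneous]] A.hproj_homogeneous[OF homogeneous] f0
      by auto
  next
    case (add x y)
    then show ?case by (simp add: B.hproj_add A.hproj_add assms(3))
  qed
qed

text \<open>An equivalence is only known to carry nonzero components onto components; that it also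
  reflects homogeneity follows from comparing projections in source and target.\<close>

lemma graded_space_equivalence_homogeneous_preimage:
  assumes "graded_vector_space s A" "graded_vector_space t B"
    and eq: "graded_space_equivalence UNIV s A UNIV t B f"
    and y: "f x \<in> B k" "x \<noteq> 0"
  shows "\<exists>g. x \<in> A g"
proof -
  interpret A: graded_vector_space s A by fact
  interpret B: graded_vector_space t B by fact
  have bij: "bij f" and f_add: "\<And>x y. f (x + y) = f x + f y"
    and comp: "\<And>g. A g \<noteq> {0} \<Longrightarrow> \<exists>h. f ` A g = B h"
    using eq by (auto simp: graded_space_equivalence_def linear_bij_def)
  have inj: "\<And>u v. f u = f v \<Longrightarrow> u = v" using bij by (meson bij_is_inj injD)
  have f0: "f 0 = 0" using f_add[of 0 0] by simp
  obtain g where g: "hproj A g x \<noteq> 0" using A.hproj_nonzero y(2) by blast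
  have "A g \<noteq> {0}" using g A.hproj_in[of g x] by auto
  then obtain l where l: "f ` A g = B l" using comp by blast
  \<comment> \<open>On elements of any degree other than \<open>g\<close> both sides vanish: by
    injectivity no second nonzero component can be mapped onto \<open>B l\<close>.\<close>
  have "hproj B l (f z) = f (hproj A g z)" for z
  proof (induction z rule: A.homogeneous_induct)
    case (homogeneous h z)
    show ?case
    proof (cases "h = g \<or> z = 0")
      case True
      then show ?thesis
        using homogeneous l B.hproj_homogeneous[of "f z" l l] A.hproj_homogeneous[OF homogeneous] f0
        by auto
    next
      case False
      then have "A h \<noteq> {0}" using homogeneous by auto
      then obtain m where m: "f ` A h = B m" using comp by blast
      have "f z \<notin> f ` A g"
        using inj A.degree_unique[OF homogeneous, of g] False by auto
      then have "m \<noteq> l" using l m homogeneous by auto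
      then have "hproj B l (f z) = 0"
        using B.hproj_homogeneous[of "f z" m l] m homogeneous by auto
      then show ?thesis using False A.hproj_homogeneous[OF homogeneous, of g] f0 by auto
    qed
  next
    case (add u v)
    then show ?case by (simp add: B.hproj_add A.hproj_add f_add)
  qed
  then have "f (hproj A g x) = hproj B l (f x)" by simp
  also have "\<dots> = (if l = k then f x else 0)" using B.hproj_homogeneous[OF y(1)] .
  \<comment> \<open>The value 0 is excluded, since \<open>g\<close> was chosen with a nonzero
    component of \<open>x\<close> and \<open>f\<close> is injective.\<close>
  finally have "hproj A g x = x" using g inj f0 by metis
  then show ?thesis using A.hproj_in[of g x] by auto
qed

section \<open>Units and inverses in graded algebras\<close>

context graded_algebra
begin

text \<open>The degree 0 part of 1 is a left identity: for \<open>x\<close> of degree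
  \<open>g\<close>, take the degree \<open>g\<close> parts in 1 * x = x. Applied to 1 itself, this
  shows that it equals 1.\<close>

lemma one_in: "1 \<in> component 0"
proof -
  let ?e = "hproj component 0 1"
  have "?e * x = x" for x
  proof (induction x rule: homogeneous_induct)
    case (homogeneous g x)
    have "hproj component (0 + g) (1 * x) = ?e * x"
      by (rule hproj_graded_map[where f = "\<lambda>z. z * x"])
        (use graded_vector_space_axioms mult_comp homogeneous in \<open>auto simp: distrib_right\<close>)
    then show ?case using hproj_homogeneous[OF homogeneous] by simp
  qed (simp add: distrib_left)
  from this[of 1] show ?thesis using hproj_in[of 0 1] by simp
qed

lemma scale_one_central: "scale a 1 * x = x * scale a 1"
  by (simp add: scale_mult_left scale_mult_right)

end

text \<open>Degree 0 parts in x * y = 1 show that the part of \<open>y\<close> of degree - g is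
  already a right inverse of \<open>x\<close>; inverses being unique, it is all of
  \<open>y\<close>.\<close>

lemma (in graded_division_algebra) homogeneous_inverse:
  assumes x: "x \<in> component g" "x \<noteq> 0"
  obtains y where "x * y = 1" "y * x = 1" "y \<in> component (- g)"
proof -
  obtain y where y: "x * y = 1" "y * x = 1" using homogeneous_invertible[OF x] by blast
  let ?z = "hproj component (- g) y"
  have "hproj component (- g + g) (x * y) = x * ?z"
    by (rule hproj_graded_map[where f = "\<lambda>z. x * z"])
      (use graded_vector_space_axioms mult_comp[OF x(1)] in \<open>auto simp: distrib_left add.commute\<close>)
  then have "x * ?z = 1" using hproj_homogeneous[OF one_in] y by simp
  then have "?z = y" by (metis y(2) mult.assoc mult_1 mult_1_right)
  then show ?thesis using that y hproj_in[of "- g" y] by simp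
qed

lemma ring_inverse_eqI:
  fixes d e :: "'d::ring_1"
  assumes "d * e = 1" "e * d = 1"
  shows "ring_inverse d = e"
  unfolding ring_inverse_def
proof (rule the_equality)
  fix x assume "d * x = 1 \<and> x * d = 1"
  then show "x = e" by (metis assms mult.assoc mult_1 mult_1_right)
qed (use assms in auto)

lemma bij_inner_aut:
  assumes "d * e = 1" "e * d = 1"
  shows "bij (inner_aut d)" and "inv (inner_aut d) x = e * x * d"
proof -
  have i: "inner_aut d x = d * x * e" for x
    by (simp add: inner_aut_def ring_inverse_eqI[OF assms])
  have cancel: "d * (e * x) = x" "e * (d * x) = x" for x
    by (simp_all flip: mult.assoc add: assms)
  have a: "inner_aut d (e * x * d) = x" "e * inner_aut d x * d = x" for x
    by (simp_all add: i mult.assoc cancel assms)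
  show b: "bij (inner_aut d)"
    by (rule o_bij[of "\<lambda>x. e * x * d"]) (auto simp: a fun_eq_iff)
  show "inv (inner_aut d) x = e * x * d"
    using a b by (simp add: bij_is_inj inv_f_eq)
qed

lemma bilinear_over_add:
  assumes "bilinear_over s t B"
  shows "B (u + v) x = B u x + B v x" and "B x (u + v) = B x u + B x v"
  using assms by (simp_all add: bilinear_over_def Vector_Spaces.linear_iff)

lemma bilinear_over_diff:
  assumes "bilinear_over s t B"
  shows "B (u - v) x = B u x - B v x" and "B x (u - v) = B x u - B x v"
  using bilinear_over_add(1)[OF assms, of "u - v" v x] bilinear_over_add(2)[OF assms, of x "u - v" v]
  by simp_all

section \<open>Graded modules over graded-division algebras\<close>

locale graded_division_module =
  D: graded_division_algebra scale Dg + graded_right_module scale Dg act Vg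
  for scale :: "'f::field \<Rightarrow> 'd::ring_1 \<Rightarrow> 'd"
    and Dg :: "'g::ab_group_add \<Rightarrow> 'd set"
    and act :: "'v::ab_group_add \<Rightarrow> 'd \<Rightarrow> 'v"
    and Vg :: "'g \<Rightarrow> 'v set" +
  assumes nontrivial: "\<exists>v::'v. v \<noteq> 0"
begin

lemma act_zero_left [simp]: "act 0 d = 0"
  using act_add_left[of 0 0 d] by simp

lemma act_zero_right [simp]: "act v 0 = 0"
  using act_add_right[of v 0 0] by simp

lemma act_minus_left: "act (- v) d = - act v d"
  using act_add_left[of v "- v" d] by (simp add: eq_neg_iff_add_eq_0 add.commute)

lemma act_minus_right: "act v (- d) = - act v d"
  using act_add_right[of v d "- d"] by (simp add: eq_neg_iff_add_eq_0 add.commute)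

lemma act_scale: "act v (scale k d) = induced_scale scale act k (act v d)"
  by (simp add: induced_scale_def D.scale_mult_right flip: act_mult)

lemma hproj_act_right:
  assumes "v \<in> Vg h"
  shows "hproj Vg (g + h) (act v d) = act v (hproj Dg g d)"
  by (rule hproj_graded_map[where f = "act v" and s = scale])
    (use graded_vector_space_axioms D.graded_vector_space_axioms act_comp[OF assms]
      in \<open>auto simp: act_add_right add.commute\<close>)

lemma ex_homogeneous:
  obtains v h where "v \<in> Vg h" "v \<noteq> 0"
  using nontrivial hproj_nonzero hproj_in by metis

section \<open>Graded submodules and homogeneous functionals\<close>

definition graded_submodule :: "'v set \<Rightarrow> bool" where
  "graded_submodule W \<longleftrightarrow> 0 \<in> W \<and> (\<forall>u\<in>W. \<forall>v\<in>W. u + v \<in> W) \<and>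
    (\<forall>u\<in>W. \<forall>d. act u d \<in> W) \<and> (\<forall>u\<in>W. \<forall>g. hproj Vg g u \<in> W)"

lemma graded_submodule_minus: "graded_submodule W \<Longrightarrow> u \<in> W \<Longrightarrow> - u \<in> W"
  using act_minus_right[of u 1] act_one[of u] unfolding graded_submodule_def by metis

lemma graded_submodule_diff: "graded_submodule W \<Longrightarrow> u \<in> W \<Longrightarrow> v \<in> W \<Longrightarrow> u - v \<in> W"
  using graded_submodule_minus[of W v] unfolding graded_submodule_def
  by (metis add_uminus_conv_diff)

text \<open>These are the enlargements of W tested against maximality. Closure under projections
  rests on \<open>v\<close> being homogeneous: the degree \<open>g\<close> part of
  \<open>act v d\<close> is \<open>v\<close> times the part of \<open>d\<close> of degree g -
  h.\<close>

lemma graded_submodule_sum_act: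
  assumes W: "graded_submodule W" and v: "v \<in> Vg h"
  shows "graded_submodule {u + act v d |u d. u \<in> W}" (is "graded_submodule ?W'")
proof -
  have "0 = 0 + act v 0" "0 \<in> W" using W by (auto simp: graded_submodule_def)
  then have "0 \<in> ?W'" by blast
  moreover have "x + y \<in> ?W'" if xy: "x \<in> ?W'" "y \<in> ?W'" for x y
  proof -
    obtain u d u' d' where "x = u + act v d" "y = u' + act v d'" "u \<in> W" "u' \<in> W"
      using xy by blast
    then have "x + y = (u + u') + act v (d + d') \<and> u + u' \<in> W"
      using W by (auto simp: graded_submodule_def act_add_right algebra_simps)
    then show ?thesis by blast
  qed
  moreover have "act x e \<in> ?W'" if x: "x \<in> ?W'" for x e
  proof -
    obtain u d where "x = u + act v d" "u \<in> W" using x by blast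
    then have "act x e = act u e + act v (d * e) \<and> act u e \<in> W"
      using W by (auto simp: graded_submodule_def act_add_left act_mult)
    then show ?thesis by blast
  qed
  moreover have "hproj Vg g x \<in> ?W'" if x: "x \<in> ?W'" for x g
  proof -
    obtain u d where "x = u + act v d" "u \<in> W" using x by blast
    then have "hproj Vg g x = hproj Vg g u + act v (hproj Dg (g - h) d) \<and> hproj Vg g u \<in> W"
      using W hproj_act_right[OF v, of "g - h" d] by (auto simp: graded_submodule_def hproj_add)
    then show ?thesis by blast
  qed
  ultimately show ?thesis unfolding graded_submodule_def by blast
qed

definition functional :: "('v \<Rightarrow> 'd) \<Rightarrow> bool" where
  "functional l \<longleftrightarrow> (\<forall>x y. l (x + y) = l x + l y) \<and> (\<forall>x d. l (act x d) = l x * d)"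

text \<open>Zorn's lemma starting from the zero submodule. Unions of nonempty chains are admissible
  because two elements always lie in a common member of the chain.\<close>

lemma ex_maximal_submodule:
  assumes "w \<noteq> 0"
  obtains W where "graded_submodule W" "w \<notin> W"
    "\<And>W'. graded_submodule W' \<Longrightarrow> W \<subseteq> W' \<Longrightarrow> w \<notin> W' \<Longrightarrow> W' = W"
proof -
  let ?S = "{W. graded_submodule W \<and> w \<notin> W}"
  have "\<exists>M\<in>?S. \<forall>X\<in>?S. M \<subseteq> X \<longrightarrow> X = M"
  proof (rule subset_Zorn_nonempty)
    have "graded_submodule {0}" by (simp add: graded_submodule_def)
    then have "{0} \<in> ?S" using assms by simp
    then show "?S \<noteq> {}" by blast
  next
    fix C assume C: "C \<noteq> {}" "subset.chain ?S C"
    then have sub: "\<And>W. W \<in> C \<Longrightarrow> graded_submodule W \<and> w \<notin> W"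
      and chain: "\<And>X Y. X \<in> C \<Longrightarrow> Y \<in> C \<Longrightarrow> X \<subseteq> Y \<or> Y \<subseteq> X"
      by (auto simp: subset_chain_def)
    have "graded_submodule (\<Union>C)"
      unfolding graded_submodule_def
    proof (intro conjI ballI allI)
      show "0 \<in> \<Union>C" using C(1) sub by (auto simp: graded_submodule_def)
    next
      fix u v assume "u \<in> \<Union>C" "v \<in> \<Union>C"
      then obtain X Y where XY: "X \<in> C" "u \<in> X" "Y \<in> C" "v \<in> Y" by blast
      then obtain Z where "Z \<in> C" "u \<in> Z" "v \<in> Z" using chain[OF XY(1,3)] by blast
      then show "u + v \<in> \<Union>C" using sub unfolding graded_submodule_def by blast
    next
      fix u d assume "u \<in> \<Union>C"
      then obtain X where X: "X \<in> C" "u \<in> X" by blast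
      then have "act u d \<in> X" using sub by (simp add: graded_submodule_def)
      then show "act u d \<in> \<Union>C" using X by blast
    next
      fix u g assume "u \<in> \<Union>C"
      then obtain X where X: "X \<in> C" "u \<in> X" by blast
      then have "hproj Vg g u \<in> X" using sub by (simp add: graded_submodule_def)
      then show "hproj Vg g u \<in> \<Union>C" using X by blast
    qed
    then show "\<Union>C \<in> ?S" using sub by blast
  qed
  then show ?thesis using that by blast
qed

text \<open>For W maximal among the graded submodules avoiding \<open>w\<close>, V is the direct sum
  of W and wD, and \<open>l\<close> is the coordinate along \<open>w\<close>.\<close>

lemma ex_homogeneous_functional:
  assumes w: "w \<in> Vg a" "w \<noteq> 0"
  obtains l where "functional l" "l w = 1" "\<And>h v. v \<in> Vg h \<Longrightarrow> l v \<in> Dg (h - a)"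
proof -
  obtain W where W: "graded_submodule W" "w \<notin> W"
    and max: "\<And>W'. graded_submodule W' \<Longrightarrow> W \<subseteq> W' \<Longrightarrow> w \<notin> W' \<Longrightarrow> W' = W"
    using ex_maximal_submodule[OF w(2)] by blast
  have Wadd: "u + v \<in> W" if "u \<in> W" "v \<in> W" for u v
    using W(1) that by (simp add: graded_submodule_def)
  have Wact: "act u d \<in> W" if "u \<in> W" for u d
    using W(1) that by (simp add: graded_submodule_def)
  have Wproj: "hproj Vg g u \<in> W" if "u \<in> W" for u g
    using W(1) that by (simp add: graded_submodule_def)
  \<comment> \<open>W meets wD trivially: a nonzero \<open>d\<close> has an invertible homogeneous
    part, and W is closed under projections and the action, so \<open>w\<close> would lie in
    W.\<close>
  have zero: "d = 0" if d: "act w d \<in> W" for d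
  proof (rule ccontr)
    assume "d \<noteq> 0"
    then obtain g where g: "hproj Dg g d \<noteq> 0" using D.hproj_nonzero by blast
    obtain y where "hproj Dg g d * y = 1" using D.homogeneous_invertible[OF D.hproj_in g] by blast
    then have "w = act (hproj Vg (g + a) (act w d)) y"
      by (simp add: hproj_act_right[OF w(1)] act_one flip: act_mult)
    then show False using W(2) Wact Wproj d by metis
  qed
  have ex: "\<exists>d. v - act w d \<in> W" for v
  proof (induction v rule: homogeneous_induct)
    case (homogeneous h v)
    show ?case
    proof (cases "v \<in> W")
      case True
      then show ?thesis by (intro exI[of _ 0]) simp
    next
      case False
      let ?W' = "{u + act v d |u d. u \<in> W}"
      have "v = 0 + act v 1" "0 \<in> W" using W(1) by (auto simp: act_one graded_submodule_def)
      then have "v \<in> ?W'" by blast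
      then have "?W' \<noteq> W" using False by blast
      moreover have "u \<in> ?W'" if "u \<in> W" for u
      proof -
        have "u = u + act v 0" by simp
        then show ?thesis using that by blast
      qed
      ultimately have "w \<in> ?W'"
        using max[OF graded_submodule_sum_act[OF W(1) homogeneous]] by blast
      \<comment> \<open>Passing to the parts of degree \<open>a\<close> makes the coefficient of
        \<open>v\<close> homogeneous. It is nonzero because \<open>w\<close> is not in W, hence
        invertible, and the equation can be solved for \<open>v\<close> modulo W.\<close>
      then obtain u d where ud: "w = u + act v d" "u \<in> W" by blast
      define u' where "u' = hproj Vg a u"
      define d' where "d' = hproj Dg (a - h) d"
      have "hproj Vg a w = u' + act v d'"
        using hproj_act_right[OF homogeneous, of "a - h" d]
        by (simp add: ud(1) hproj_add u'_def d'_def)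
      then have w': "w = u' + act v d'" using hproj_homogeneous[OF w(1)] by simp
      have u': "u' \<in> W" using Wproj ud(2) u'_def by simp
      have "d' \<noteq> 0" using w' u' W(2) by auto
      then obtain y where "d' * y = 1"
        using D.homogeneous_invertible[OF D.hproj_in] unfolding d'_def by blast
      then have "act w y = act u' y + v" by (simp add: w' act_add_left act_one flip: act_mult)
      then have "v - act w y = - act u' y" by simp
      then show ?thesis using graded_submodule_minus[OF W(1) Wact[OF u']] by metis
    qed
  next
    case (add x y)
    then obtain d e where "x - act w d \<in> W" "y - act w e \<in> W" by blast
    then have "(x - act w d) + (y - act w e) \<in> W" using Wadd by blast
    moreover have "(x - act w d) + (y - act w e) = (x + y) - act w (d + e)"
      by (simp add: act_add_right)
    ultimately show ?case by metis
  qed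
  define l where "l v = (THE d. v - act w d \<in> W)" for v
  have unique: "d = e" if "v - act w d \<in> W" "v - act w e \<in> W" for v d e
  proof -
    have "(v - act w d) - (v - act w e) = act w (e - d)"
      by (simp only: diff_conv_add_uminus act_add_right act_minus_right) simp
    then have "act w (e - d) \<in> W" using graded_submodule_diff[OF W(1) that] by simp
    then show ?thesis using zero by fastforce
  qed
  have l_eq: "l v = d" if "v - act w d \<in> W" for v d
    unfolding l_def using that unique by blast
  have l_in: "v - act w (l v) \<in> W" for v
    using ex[of v] l_eq by blast
  show thesis
  proof (rule that)
    have "l (x + y) = l x + l y" for x y
    proof (rule l_eq)
      have "x + y - act w (l x + l y) = (x - act w (l x)) + (y - act w (l y))"
        by (simp add: act_add_right)
      then show "x + y - act w (l x + l y) \<in> W" using Wadd l_in by metis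
    qed
    moreover have "l (act x d) = l x * d" for x d
    proof (rule l_eq)
      have "act x d - act w (l x * d) = act (x - act w (l x)) d"
        by (simp only: diff_conv_add_uminus act_add_left act_minus_left act_mult)
      then show "act x d - act w (l x * d) \<in> W" using Wact l_in by metis
    qed
    ultimately show "functional l" by (simp add: functional_def)
    show "l w = 1" by (rule l_eq) (use W(1) in \<open>simp add: act_one graded_submodule_def\<close>)
    show "l v \<in> Dg (h - a)" if v: "v \<in> Vg h" for h v
    proof -
      \<comment> \<open>The degree \<open>h\<close> part of this decomposition is again a
        decomposition of \<open>v\<close>, with coefficient the part of \<open>l v\<close> of degree
        h - a; uniqueness of the coefficient makes \<open>l v\<close> homogeneous.\<close>
      have "v = (v - act w (l v)) + act w (l v)" by simp
      then have "hproj Vg h v = hproj Vg h (v - act w (l v)) + hproj Vg h (act w (l v))"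
        by (metis hproj_add)
      then have "v = hproj Vg h (v - act w (l v)) + act w (hproj Dg (h - a) (l v))"
        using hproj_act_right[OF w(1), of "h - a" "l v"] hproj_homogeneous[OF v] by simp
      then have "v - act w (hproj Dg (h - a) (l v)) = hproj Vg h (v - act w (l v))"
        by (metis add_diff_cancel_right')
      then have "l v = hproj Dg (h - a) (l v)" using l_eq Wproj l_in by metis
      then show ?thesis using D.hproj_in by metis
    qed
  qed
qed

lemma act_cancel:
  assumes "w \<in> Vg a" "w \<noteq> 0" "act w d = act w e"
  shows "d = e"
proof -
  obtain l where "functional l" "l w = 1"
    using ex_homogeneous_functional[OF assms(1,2)] by metis
  then show ?thesis using assms(3) unfolding functional_def by (metis mult_1)
qed

section \<open>Rank one operators and the centralizer of the endomorphism algebra\<close>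

lemma rank_one_in_End: "functional l \<Longrightarrow> (\<lambda>x. act v (l x)) \<in> End_D act"
  by (simp add: functional_def End_D_def act_add_right act_mult)

lemma rank_one_in_comp:
  assumes "functional l" "\<And>h x. x \<in> Vg h \<Longrightarrow> l x \<in> Dg (h - a)" "v \<in> Vg b"
  shows "(\<lambda>x. act v (l x)) \<in> End_comp act Vg (b - a)"
  using rank_one_in_End[OF assms(1)] act_comp[OF assms(3)] assms(2)
  by (fastforce simp: End_comp_def algebra_simps)

text \<open>Commutation with the rank one operator taking \<open>w\<close> to \<open>v\<close>,
  evaluated at \<open>w\<close>, exhibits the factor as \<open>l (f w)\<close>, which does not
  depend on \<open>v\<close>.\<close>

lemma centralizer_of_End:
  assumes comm: "\<And>r x. r \<in> End_D act \<Longrightarrow> f (r x) = r (f x)"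
  obtains d where "\<And>v. f v = act v d"
proof -
  obtain w a where w: "w \<in> Vg a" "w \<noteq> 0" using ex_homogeneous .
  then obtain l where l: "functional l" "l w = 1" using ex_homogeneous_functional by metis
  have "f v = act v (l (f w))" for v
    using comm[OF rank_one_in_End[OF l(1)], of v w] l(2) by (simp add: act_one)
  then show ?thesis using that by blast
qed

section \<open>Forms representing an antiautomorphism\<close>

lemma ex_dual_vector:
  assumes rep: "represents scale Dg act Vg \<phi>0 B \<phi>"
    and \<phi>: "bij_betw \<phi> (End_D act) (End_D act)"
    and w: "w \<in> Vg a" "w \<noteq> 0"
    and l: "functional l" "l w = 1" "\<And>h x. x \<in> Vg h \<Longrightarrow> l x \<in> Dg (h - a)"
  obtains v b where "v \<in> Vg b" "v \<noteq> 0" "\<And>x. B v x = l x"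
proof -
  have "bilinear_over (induced_scale scale act) scale B" using rep by (simp add: represents_def)
  note B_add = bilinear_over_add[OF this]
  have nondeg: "\<exists>v. B v w \<noteq> 0"
    using rep w(2) unfolding represents_def nondegenerate_def by metis
  have B_left: "B (act u d) x = \<phi>0 d * B u x" and B_right: "B u (act x d) = B u x * d" for u x d
    using rep by (auto simp: represents_def)
  have adj: "B (r u) x = B u (\<phi> r x)" if "r \<in> End_D act" for r u x
    using rep that by (auto simp: represents_def)
  obtain g0 where g0: "\<And>h k u x. u \<in> Vg h \<Longrightarrow> x \<in> Vg k \<Longrightarrow> B u x \<in> Dg (g0 + h + k)"
    using rep unfolding represents_def by metis
  \<comment> \<open>Homogeneity of the first vector is needed so that its pairing with
    \<open>w\<close> is homogeneous and therefore invertible.\<close>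
  have "\<exists>v b. v \<in> Vg b \<and> B v w \<noteq> 0"
  proof (rule ccontr)
    assume *: "\<not> ?thesis"
    have "B v w = 0" for v
    proof (induction v rule: homogeneous_induct)
      case (add x y)
      then show ?case by (simp add: B_add)
    qed (use * in blast)
    then show False using nondeg by blast
  qed
  then obtain v0 b where v0: "v0 \<in> Vg b" "B v0 w \<noteq> 0" by blast
  obtain y where y: "y * B v0 w = 1"
    using D.homogeneous_invertible[OF g0[OF v0(1) w(1)] v0(2)] by blast
  have "bij \<phi>0"
    using rep by (simp add: represents_def degree_preserving_antiautomorphism_def linear_bij_def)
  \<comment> \<open>The action on the first argument multiplies values by \<open>\<phi>0 t\<close>,
    so the normalizing factor \<open>y\<close> has to be pulled back along
    \<open>\<phi>0\<close>.\<close>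
  then obtain t where t: "\<phi>0 t = y" by (metis bij_pointE)
  obtain p where p: "p \<in> End_D act" "\<phi> p = (\<lambda>x. act w (l x))"
    using \<phi> rank_one_in_End[OF l(1)] by (metis bij_betw_imp_surj_on image_iff)
  define v2 where "v2 = act (p v0) t"
  have v2: "B v2 x = l x" for x
    using y by (simp add: v2_def B_left t adj[OF p(1)] p(2) B_right flip: mult.assoc)
  \<comment> \<open>This is the degree for which pairing with degree \<open>h\<close> lands in
    degree h - a, where \<open>l\<close> takes its values.\<close>
  define v1 where "v1 = hproj Vg (- g0 - a) v2"
  have "B v1 x = l x" for x
  proof (induction x rule: homogeneous_induct)
    case (homogeneous h x)
    have "hproj Dg (- g0 - a + (g0 + h)) (B v2 x) = B v1 x"
      unfolding v1_def
      by (rule hproj_graded_map[where f = "\<lambda>u. B u x"])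
        (use graded_vector_space_axioms D.graded_vector_space_axioms g0[OF _ homogeneous]
          in \<open>auto simp: B_add algebra_simps\<close>)
    then show ?case using v2[of x] D.hproj_homogeneous[OF l(3)[OF homogeneous]] by simp
  next
    case (add x y)
    then show ?case
      using l(1) by (simp add: functional_def B_add)
  qed
  moreover have "v1 \<noteq> 0" using calculation[of w] l(2) B_add(1)[of 0 0 w] by auto
  ultimately show thesis using that hproj_in unfolding v1_def by blast
qed

text \<open>
  The conditions on \<open>C\<close> say that it has the same adjoint operation as \<open>B\<close>; if
  $B(v,\cdot)$ is the functional dual to $w$, then the constant relating the two forms is $C(v,w)$.
\<close>

lemma forms_proportional:
  assumes rep: "represents scale Dg act Vg \<phi>0 B \<phi>"
    and \<phi>: "bij_betw \<phi> (End_D act) (End_D act)"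
    and C_right: "\<And>u x d. C u (act x d) = C u x * d"
    and C_adj: "\<And>r u x. r \<in> End_D act \<Longrightarrow> C (r u) x = C u (\<phi> r x)"
  obtains v b w a where "v \<in> Vg b" "w \<in> Vg a" "\<And>u x. C u x = C v w * B u x"
proof -
  have "bilinear_over (induced_scale scale act) scale B" using rep by (simp add: represents_def)
  note diff = bilinear_over_diff[OF this]
  have nondeg: "u = 0" if "\<And>x. B u x = 0" for u
    using rep that by (simp add: represents_def nondegenerate_def)
  have B_right: "B u (act x d) = B u x * d" for u x d
    using rep by (simp add: represents_def)
  have adj: "B (r u) x = B u (\<phi> r x)" if "r \<in> End_D act" for r u x
    using rep that by (simp add: represents_def)
  obtain w a where w: "w \<in> Vg a" "w \<noteq> 0" using ex_homogeneous .
  obtain l where l: "functional l" "l w = 1" "\<And>h x. x \<in> Vg h \<Longrightarrow> l x \<in> Dg (h - a)"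
    using ex_homogeneous_functional[OF w] by metis
  obtain v b where v: "v \<in> Vg b" "v \<noteq> 0" "\<And>x. B v x = l x"
    using ex_dual_vector[OF rep \<phi> w l] by blast
  obtain p where p: "p \<in> End_D act" "\<phi> p = (\<lambda>x. act w (l x))"
    using \<phi> rank_one_in_End[OF l(1)] by (metis bij_betw_imp_surj_on image_iff)
  have "B (p v - v) x = 0" for x
    by (simp add: diff adj[OF p(1)] p(2) B_right v(3) l(2))
  then have "p v = v" using nondeg[of "p v - v"] by simp
  then have Cv: "C v x = C v w * B v x" for x
    using C_adj[OF p(1), of v x] by (simp add: p(2) C_right v(3))
  obtain m where m: "functional m" "m v = 1" using ex_homogeneous_functional[OF v(1,2)] by metis
  have "C u x = C v w * B u x" for u x
  proof -
    \<comment> \<open>This operator takes \<open>v\<close> to \<open>u\<close>; its adjoint, common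
      to both forms, carries the proportionality from \<open>v\<close> to every
      \<open>u\<close>.\<close>
    let ?r = "\<lambda>x. act u (m x)"
    have r: "?r \<in> End_D act" by (rule rank_one_in_End[OF m(1)])
    have "C u x = C v (\<phi> ?r x)" using C_adj[OF r, of v x] by (simp add: m(2) act_one)
    also have "\<dots> = C v w * B v (\<phi> ?r x)" by (rule Cv)
    also have "B v (\<phi> ?r x) = B u x" using adj[OF r, of v x] by (simp add: m(2) act_one)
    finally show ?thesis .
  qed
  then show thesis using that v(1) w(1) by blast
qed

end

section \<open>Equivalences of endomorphism algebras\<close>

locale graded_module_pair =
  M: graded_division_module sD Dg act Vg + N: graded_division_module sD' Dg' act' Vg'
  for sD :: "'f::field \<Rightarrow> 'd::ring_1 \<Rightarrow> 'd"
    and Dg :: "'g::ab_group_add \<Rightarrow> 'd set"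
    and act :: "'v::ab_group_add \<Rightarrow> 'd \<Rightarrow> 'v"
    and Vg :: "'g \<Rightarrow> 'v set"
    and sD' :: "'f \<Rightarrow> 'e::ring_1 \<Rightarrow> 'e"
    and Dg' :: "'h::ab_group_add \<Rightarrow> 'e set"
    and act' :: "'w::ab_group_add \<Rightarrow> 'e \<Rightarrow> 'w"
    and Vg' :: "'h \<Rightarrow> 'w set" +
  fixes \<psi> :: "('v \<Rightarrow> 'v) \<Rightarrow> ('w \<Rightarrow> 'w)"
  assumes equivalence: "graded_algebra_equivalence
           (End_D act) (\<circ>) (End_scale sD act) (End_comp act Vg)
           (End_D act') (\<circ>) (End_scale sD' act') (End_comp act' Vg') \<psi>"
begin

section \<open>Elementary properties of the given equivalence\<close>

lemma psi_bij: "bij_betw \<psi> (End_D act) (End_D act')"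
  and psi_add: "r \<in> End_D act \<Longrightarrow> s \<in> End_D act \<Longrightarrow> \<psi> (r + s) = \<psi> r + \<psi> s"
  and psi_scale: "r \<in> End_D act \<Longrightarrow> \<psi> (End_scale sD act k r) = End_scale sD' act' k (\<psi> r)"
  and psi_comp: "r \<in> End_D act \<Longrightarrow> s \<in> End_D act \<Longrightarrow> \<psi> (r \<circ> s) = \<psi> r \<circ> \<psi> s"
  and psi_image: "End_comp act Vg g \<noteq> {0} \<Longrightarrow> \<exists>h. \<psi> ` End_comp act Vg g = End_comp act' Vg' h"
  using equivalence
  by (auto simp: graded_algebra_equivalence_def graded_space_equivalence_def linear_bij_def)

lemma psi_in: "r \<in> End_D act \<Longrightarrow> \<psi> r \<in> End_D act'"
  using psi_bij by (rule bij_betwE[THEN bspec])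

lemma psi_surj: assumes "s \<in> End_D act'" obtains r where "r \<in> End_D act" "\<psi> r = s"
  using psi_bij assms by (metis bij_betw_imp_surj_on image_iff)

lemma psi_inj: "r \<in> End_D act \<Longrightarrow> s \<in> End_D act \<Longrightarrow> \<psi> r = \<psi> s \<Longrightarrow> r = s"
  using psi_bij by (meson bij_betw_imp_inj_on inj_onD)

lemma zero_in_End: "0 \<in> End_D act"
  by (simp add: End_D_def)

lemma psi_zero: "\<psi> 0 = 0"
  using psi_add[OF zero_in_End zero_in_End] by simp

lemma id_in_End: "id \<in> End_D act" "id \<in> End_D act'"
  by (simp_all add: End_D_def)

lemma psi_id: "\<psi> id = id"
proof -
  obtain r where r: "r \<in> End_D act" "\<psi> r = id" using psi_surj id_in_End by blast
  have "\<psi> id \<circ> \<psi> r = \<psi> (id \<circ> r)" using psi_comp[OF id_in_End(1) r(1)] by simp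
  then show ?thesis using r(2) by (metis comp_id id_comp)
qed

text \<open>An equivalence may relabel degrees, but the image component contains the identity, which
  fixes a nonzero homogeneous vector and so can only have degree 0.\<close>

lemma psi_image_zero: "\<psi> ` End_comp act Vg 0 = End_comp act' Vg' 0"
proof -
  have id: "id \<in> End_comp act Vg 0" using id_in_End by (simp add: End_comp_def)
  obtain v where v: "v \<noteq> (0::'v)" using M.nontrivial by blast
  have "id \<noteq> (0 :: 'v \<Rightarrow> 'v)" using v by (metis id_apply zero_fun_apply)
  then obtain k where k: "\<psi> ` End_comp act Vg 0 = End_comp act' Vg' k"
    using psi_image[of 0] id by blast
  then have idk: "id \<in> End_comp act' Vg' k" using id psi_id by force
  obtain w h where w: "w \<in> Vg' h" "w \<noteq> 0" using N.ex_homogeneous .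
  have "w \<in> Vg' (k + h)" using idk w(1) by (force simp: End_comp_def)
  then have "k = 0" using N.degree_unique[OF w(1) _ w(2)] by fastforce
  then show ?thesis using k by simp
qed

section \<open>Construction of an inducing pair\<close>

text \<open>The image \<open>e'\<close> of the idempotent is shown to factor through a rank one
  operator \<open>p\<close> on V'. The factorization is found in the corner of R cut out by the
  idempotent, where the element corresponding to \<open>p\<close> is invertible.\<close>

lemma image_rank_one_idempotent:
  assumes v: "v \<in> Vg a" "v \<noteq> 0"
    and l: "M.functional l" "l v = 1" "\<And>h x. x \<in> Vg h \<Longrightarrow> l x \<in> Dg (h - a)"
  obtains w h l' where "w \<in> Vg' h" "w \<noteq> 0" "\<psi> (\<lambda>x. act v (l x)) w = w"
    "N.functional l'" "l' w = 1" "\<And>k x. x \<in> Vg' k \<Longrightarrow> l' x \<in> Dg' (k - h)"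
    "\<And>z. \<psi> (\<lambda>x. act v (l x)) z = act' w (l' (\<psi> (\<lambda>x. act v (l x)) z))"
proof -
  define E where "E u = (\<lambda>x. act u (l x))" for u
  have E_in: "E u \<in> End_D act" for u unfolding E_def by (rule M.rank_one_in_End[OF l(1)])
  define e' where "e' = \<psi> (E v)"
  have e'_in: "e' \<in> End_D act'" unfolding e'_def by (rule psi_in[OF E_in])
  have l_add: "l (x + y) = l x + l y" and l_act: "l (act x d) = l x * d" for x y d
    using l(1) by (auto simp: M.functional_def)
  have "E v \<circ> E v = E v" by (auto simp: E_def fun_eq_iff l_act l(2))
  then have idem: "e' (e' z) = e' z" for z
    unfolding e'_def using psi_comp[OF E_in E_in, of v v] by (metis comp_apply)
  have Ev0: "E v \<in> End_comp act Vg 0"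
    using M.rank_one_in_comp[OF l(1,3) v(1)] by (simp add: E_def)
  then have e'0: "e' \<in> End_comp act' Vg' 0" unfolding e'_def using psi_image_zero by blast
  have "E v v \<noteq> 0" using v by (simp add: E_def l M.act_one)
  then have "E v \<noteq> 0" by auto
  then have e'_nz: "e' \<noteq> 0" unfolding e'_def using psi_inj[OF E_in zero_in_End] psi_zero by metis
  \<comment> \<open>Since \<open>e'\<close> has degree 0 and is idempotent, its value at such an
    \<open>x\<close> is a nonzero homogeneous vector that it fixes.\<close>
  have "\<exists>x h. x \<in> Vg' h \<and> e' x \<noteq> 0"
  proof (rule ccontr)
    assume *: "\<not> ?thesis"
    have "e' x = 0" for x
    proof (induction x rule: N.homogeneous_induct)
      case (add x y)
      then show ?case using e'_in by (simp add: End_D_def)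
    qed (use * in blast)
    then show False using e'_nz by (auto simp: fun_eq_iff)
  qed
  then obtain x h where x: "x \<in> Vg' h" "e' x \<noteq> 0" by blast
  define w where "w = e' x"
  have w: "w \<in> Vg' h" "w \<noteq> 0" using x e'0 by (force simp: End_comp_def w_def)+
  have e'w: "e' w = w" by (simp add: w_def idem)
  obtain l' where l': "N.functional l'" "l' w = 1" "\<And>k x. x \<in> Vg' k \<Longrightarrow> l' x \<in> Dg' (k - h)"
    using N.ex_homogeneous_functional[OF w] by metis
  define p where "p = (\<lambda>x. act' w (l' x))"
  have "p \<in> End_comp act' Vg' 0" using N.rank_one_in_comp[OF l'(1,3) w(1)] by (simp add: p_def)
  then obtain q where q: "q \<in> End_comp act Vg 0" "\<psi> q = p" using psi_image_zero by (metis imageE)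
  have q_in: "q \<in> End_D act" using q by (simp add: End_comp_def)
  \<comment> \<open>The element of $D$ corresponding to the compression of \<open>q\<close> to the
    corner. As \<open>q\<close> has degree 0, so does \<open>c\<close>, and it is invertible as soon
    as it is nonzero.\<close>
  define c where "c = l (q v)"
  have "q v \<in> Vg a" using q(1) v(1) by (force simp: End_comp_def)
  then have c: "c \<in> Dg 0" using l(3) by (fastforce simp: c_def)
  have "E v \<circ> (q \<circ> E v) = E (act v c)"
    using q_in by (auto simp: E_def fun_eq_iff End_D_def l_act c_def M.act_mult)
  moreover have "\<psi> (E v \<circ> (q \<circ> E v)) = e' \<circ> (p \<circ> e')"
  proof -
    have "q \<circ> E v \<in> End_D act" using q_in E_in[of v] by (simp add: End_D_def)
    then show ?thesis by (simp add: psi_comp E_in q_in q(2) e'_def)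
  qed
  ultimately have Ec: "\<psi> (E (act v c)) = e' \<circ> (p \<circ> e')" by simp
  \<comment> \<open>The operator $e' p e'$ fixes \<open>w\<close>, so the compression is not
    zero.\<close>
  have "c \<noteq> 0"
  proof
    assume "c = 0"
    then have "E (act v c) = 0" by (auto simp: E_def)
    then have "e' (p (e' w)) = 0" using Ec psi_zero by (metis comp_apply zero_fun_apply)
    then show False using w(2) by (simp add: e'w p_def l'(2) N.act_one)
  qed
  then obtain y where y: "c * y = 1" using M.D.homogeneous_invertible[OF c] by blast
  have "E (act v c) \<circ> E (act v y) = E v"
  proof
    fix x
    have "E (act v c) (E (act v y) x) = act v (c * y * l x)"
      by (simp add: E_def l_act l(2) M.act_mult)
    then show "(E (act v c) \<circ> E (act v y)) x = E v x" using y by (simp add: E_def)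
  qed
  \<comment> \<open>Inverting the compression within the corner expresses the idempotent, and hence
    \<open>e'\<close>, as a product containing \<open>p\<close>.\<close>
  then have e'_eq: "e' = e' \<circ> (p \<circ> e') \<circ> \<psi> (E (act v y))"
    using psi_comp[OF E_in E_in, of "act v c" "act v y"] Ec by (simp add: e'_def)
  have "e' z = act' w (l' (e' z))" for z
  proof -
    define u where "u = e' (\<psi> (E (act v y)) z)"
    have "e' z = e' (p u)" using e'_eq by (metis comp_apply u_def)
    then have "e' z = act' w (l' u)" using e'_in e'w by (simp add: p_def End_D_def)
    then show ?thesis using l'(1,2) by (simp add: N.functional_def)
  qed
  then show thesis using that[OF w _ l'] e'w by (simp add: e'_def E_def)
qed

text \<open>The map \<open>E\<close> identifies V with the left ideal of R generated by the
  idempotent \<open>E v1\<close>, and evaluation at \<open>w\<close> identifies the image of this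
  ideal with V'. Through these identifications \<open>\<psi>\<close> itself becomes
  \<open>\<psi>1\<close>.\<close>

lemma ex_intertwiner:
  obtains \<psi>1 where
    "graded_space_equivalence UNIV (induced_scale sD act) Vg UNIV (induced_scale sD' act') Vg' \<psi>1"
    "\<And>r v. r \<in> End_D act \<Longrightarrow> \<psi>1 (r v) = \<psi> r (\<psi>1 v)"
proof -
  obtain v1 a where v1: "v1 \<in> Vg a" "v1 \<noteq> 0" using M.ex_homogeneous .
  obtain l where l: "M.functional l" "l v1 = 1" "\<And>h x. x \<in> Vg h \<Longrightarrow> l x \<in> Dg (h - a)"
    using M.ex_homogeneous_functional[OF v1] by metis
  define E where "E u = (\<lambda>x. act u (l x))" for u
  have E_in: "E u \<in> End_D act" for u unfolding E_def by (rule M.rank_one_in_End[OF l(1)])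
  have E_comp: "E u \<in> End_comp act Vg (b - a)" if "u \<in> Vg b" for u b
    unfolding E_def by (rule M.rank_one_in_comp[OF l(1,3) that])
  have E_v1: "E u v1 = u" for u by (simp add: E_def l(2) M.act_one)
  have E_End: "r \<circ> E u = E (r u)" if "r \<in> End_D act" for r u
    using that by (auto simp: E_def End_D_def)
  obtain w h l' where w: "w \<in> Vg' h" "w \<noteq> 0" "\<psi> (E v1) w = w"
    and l': "N.functional l'" "l' w = 1" "\<And>k x. x \<in> Vg' k \<Longrightarrow> l' x \<in> Dg' (k - h)"
    and e': "\<And>z. \<psi> (E v1) z = act' w (l' (\<psi> (E v1) z))"
    using image_rank_one_idempotent[OF v1 l] unfolding E_def by metis
  define \<psi>1 where "\<psi>1 v = \<psi> (E v) w" for v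
  have intertwine: "\<psi>1 (r v) = \<psi> r (\<psi>1 v)" if "r \<in> End_D act" for r v
    using psi_comp[OF that E_in, of v] E_End[OF that, of v] by (simp add: \<psi>1_def)
  \<comment> \<open>A vector \<open>u\<close> of V' is the value at \<open>w\<close> of a rank one
    operator; this lifts it through \<open>\<psi>\<close>, and is used both for surjectivity and for
    surjectivity onto components.\<close>
  have preimage: "\<psi>1 (r v1) = u" if "r \<in> End_D act" "\<psi> r = (\<lambda>x. act' u (l' x))" for r u
    using intertwine[OF that(1), of v1] by (simp add: that(2) \<psi>1_def w(3) l'(2) N.act_one)
  have add: "\<psi>1 (u + v) = \<psi>1 u + \<psi>1 v" for u v
  proof -
    have "E (u + v) = E u + E v" by (auto simp: E_def M.act_add_left)
    then show ?thesis by (simp add: \<psi>1_def psi_add E_in)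
  qed
  have scale: "\<psi>1 (induced_scale sD act k v) = induced_scale sD' act' k (\<psi>1 v)" for k v
  proof -
    have "E (induced_scale sD act k v) = End_scale sD act k (E v)"
      by (auto simp: E_def induced_scale_def End_scale_def M.D.scale_one_central simp flip: M.act_mult)
    then show ?thesis by (simp add: \<psi>1_def psi_scale E_in) (simp add: End_scale_def)
  qed
  have kernel: "v = 0" if "\<psi>1 v = 0" for v
  proof -
    \<comment> \<open>After applying \<open>\<psi>\<close>, the right factor has image in wD', where
      the left factor vanishes as soon as it kills \<open>w\<close>.\<close>
    have "E v = E v \<circ> E v1" using E_End[OF E_in, of v v1] E_v1 by simp
    then have "\<psi> (E v) = \<psi> (E v) \<circ> \<psi> (E v1)" using psi_comp[OF E_in E_in, of v v1] by simp
    then have "\<psi> (E v) z = \<psi> (E v) (act' w (l' (\<psi> (E v1) z)))" for z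
      using e' by (metis comp_apply)
    then have "\<psi> (E v) z = 0" for z
      using psi_in[OF E_in, of v] that by (simp add: End_D_def \<psi>1_def)
    then have "E v = 0" using psi_inj[OF E_in zero_in_End] psi_zero by (metis ext zero_fun_apply)
    then show ?thesis using E_v1 by (metis zero_fun_apply)
  qed
  have "bij \<psi>1"
  proof (rule bijI)
    show "inj \<psi>1"
    proof (rule injI)
      fix u v assume "\<psi>1 u = \<psi>1 v"
      then have "\<psi>1 (u - v) = 0" using add[of "u - v" v] by simp
      then show "u = v" using kernel by fastforce
    qed
    have "u \<in> range \<psi>1" for u
      using psi_surj[OF N.rank_one_in_End[OF l'(1)]] preimage by (metis rangeI)
    then show "surj \<psi>1" by blast
  qed
  moreover have "\<exists>m. \<psi>1 ` Vg b = Vg' m" if b: "Vg b \<noteq> {0}" for b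
  proof -
    obtain v where v: "v \<in> Vg b" "v \<noteq> 0" using b M.zero_in[of b] by blast
    then have "E v \<noteq> 0" using E_v1[of v] by auto
    then have "End_comp act Vg (b - a) \<noteq> {0}" using E_comp[OF v(1)] by blast
    then obtain k where k: "\<psi> ` End_comp act Vg (b - a) = End_comp act' Vg' k"
      using psi_image by blast
    \<comment> \<open>Degree \<open>b\<close> in V corresponds to operator degree b - a, which
      \<open>\<psi>\<close> sends to \<open>k\<close>; evaluation at \<open>w\<close> adds its
      degree \<open>h\<close>.\<close>
    have "\<psi>1 v \<in> Vg' (k + h)" if "v \<in> Vg b" for v
    proof -
      have "\<psi> (E v) \<in> End_comp act' Vg' k" using k E_comp[OF that] by blast
      then show ?thesis using w(1) by (auto simp: End_comp_def \<psi>1_def)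
    qed
    moreover have "u \<in> \<psi>1 ` Vg b" if u: "u \<in> Vg' (k + h)" for u
    proof -
      have "(\<lambda>x. act' u (l' x)) \<in> End_comp act' Vg' k"
        using N.rank_one_in_comp[OF l'(1,3) u] by simp
      then obtain r where r: "r \<in> End_comp act Vg (b - a)" "\<psi> r = (\<lambda>x. act' u (l' x))"
        using k by (metis imageE)
      then have "\<psi>1 (r v1) = u" using preimage by (simp add: End_comp_def)
      moreover have "r v1 \<in> Vg b" using r(1) v1(1) by (force simp: End_comp_def)
      ultimately show ?thesis by blast
    qed
    ultimately show ?thesis by blast
  qed
  ultimately show thesis
    using that[of \<psi>1] intertwine add scale
    by (simp add: graded_space_equivalence_def linear_bij_def)
qed

text \<open>Right multiplication by \<open>d\<close>, transported by \<open>\<psi>1\<close>,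
  commutes with R', so it is right multiplication by an element taken as \<open>\<psi>0 d\<close>.
  The properties of \<open>\<psi>0\<close> follow by comparing coefficients of the homogeneous
  vector \<open>w\<close>.\<close>

lemma ex_induces:
  obtains \<psi>0 \<psi>1 where "induces sD Dg act Vg sD' Dg' act' Vg' \<psi>0 \<psi>1 \<psi>"
proof -
  obtain \<psi>1 where eq:
    "graded_space_equivalence UNIV (induced_scale sD act) Vg UNIV (induced_scale sD' act') Vg' \<psi>1"
    and intertwine: "\<And>r v. r \<in> End_D act \<Longrightarrow> \<psi>1 (r v) = \<psi> r (\<psi>1 v)"
    using ex_intertwiner by blast
  have bij: "bij \<psi>1" and add: "\<And>u v. \<psi>1 (u + v) = \<psi>1 u + \<psi>1 v"
    and scale: "\<And>k v. \<psi>1 (induced_scale sD act k v) = induced_scale sD' act' k (\<psi>1 v)"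
    and image: "\<And>b. Vg b \<noteq> {0} \<Longrightarrow> \<exists>m. \<psi>1 ` Vg b = Vg' m"
    using eq by (auto simp: graded_space_equivalence_def linear_bij_def)
  have inv1: "\<psi>1 (inv \<psi>1 u) = u" "inv \<psi>1 (\<psi>1 v) = v" for u v
    using bij by (simp_all add: bij_is_surj surj_f_inv_f bij_is_inj)
  have zero: "\<psi>1 0 = 0" using add[of 0 0] by simp
  have "\<exists>e. \<forall>v. \<psi>1 (act v d) = act' (\<psi>1 v) e" for d
  proof -
    have "\<psi>1 (act (inv \<psi>1 (s u)) d) = s (\<psi>1 (act (inv \<psi>1 u) d))" if s: "s \<in> End_D act'" for s u
    proof -
      obtain r where r: "r \<in> End_D act" "\<psi> r = s" using psi_surj[OF s] .
      have "s u = \<psi>1 (r (inv \<psi>1 u))" using intertwine[OF r(1)] r(2) inv1 by simp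
      then have "\<psi>1 (act (inv \<psi>1 (s u)) d) = \<psi>1 (r (act (inv \<psi>1 u) d))"
        using inv1 r(1) by (simp add: End_D_def)
      then show ?thesis using intertwine[OF r(1)] r(2) by simp
    qed
    then obtain e where "\<And>u. \<psi>1 (act (inv \<psi>1 u) d) = act' u e"
      using N.centralizer_of_End[of "\<lambda>u. \<psi>1 (act (inv \<psi>1 u) d)"] by blast
    then show ?thesis using inv1(2) by metis
  qed
  then obtain \<psi>0 where semi: "\<And>v d. \<psi>1 (act v d) = act' (\<psi>1 v) (\<psi>0 d)" by metis
  obtain v1 a where v1: "v1 \<in> Vg a" "v1 \<noteq> 0" using M.ex_homogeneous .
  then obtain h where h: "\<psi>1 ` Vg a = Vg' h" using image[of a] by auto
  define w where "w = \<psi>1 v1"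
  have w: "w \<in> Vg' h" "w \<noteq> 0"
    using h v1 zero inv1(2) unfolding w_def by (blast, metis)
  have cancel: "d = e" if "act' w d = act' w e" for d e using N.act_cancel[OF w that] .
  have semi1: "\<psi>1 (act v1 d) = act' w (\<psi>0 d)" for d by (simp add: semi w_def)
  have add0: "\<psi>0 (d + e) = \<psi>0 d + \<psi>0 e" for d e
    by (rule cancel) (simp add: M.act_add_right N.act_add_right add flip: semi1)
  have mult0: "\<psi>0 (d * e) = \<psi>0 d * \<psi>0 e" for d e
  proof (rule cancel)
    have "act' w (\<psi>0 (d * e)) = \<psi>1 (act (act v1 d) e)" by (simp add: semi1 flip: M.act_mult)
    then show "act' w (\<psi>0 (d * e)) = act' w (\<psi>0 d * \<psi>0 e)" by (simp add: semi w_def N.act_mult)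
  qed
  have scale0: "\<psi>0 (sD k d) = sD' k (\<psi>0 d)" for k d
  proof (rule cancel)
    have "act' w (\<psi>0 (sD k d)) = \<psi>1 (induced_scale sD act k (act v1 d))"
      by (simp only: semi1[symmetric] M.act_scale)
    also have "\<dots> = act' w (sD' k (\<psi>0 d))"
      by (simp only: scale semi1 N.act_scale)
    finally show "act' w (\<psi>0 (sD k d)) = act' w (sD' k (\<psi>0 d))" .
  qed
  have inj0: "d = e" if "\<psi>0 d = \<psi>0 e" for d e
    using semi1[of d] semi1[of e] that inv1(2) M.act_cancel[OF v1] by metis
  \<comment> \<open>The same centralizer argument in the opposite direction: right multiplication by
    \<open>e\<close> is pulled back to V.\<close>
  have surj0: "\<exists>d. \<psi>0 d = e" for e
  proof -
    have "inv \<psi>1 (act' (\<psi>1 (r v)) e) = r (inv \<psi>1 (act' (\<psi>1 v) e))" if r: "r \<in> End_D act" for r v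
    proof -
      have "\<psi>1 (r (inv \<psi>1 (act' (\<psi>1 v) e))) = act' (\<psi>1 (r v)) e"
        using psi_in[OF r] by (simp add: intertwine[OF r] inv1 End_D_def)
      then show ?thesis using inv1(2) by metis
    qed
    then obtain d where "\<And>v. inv \<psi>1 (act' (\<psi>1 v) e) = act v d"
      using M.centralizer_of_End[of "\<lambda>v. inv \<psi>1 (act' (\<psi>1 v) e)"] by blast
    then have "\<psi>1 (act v1 d) = act' w e" using inv1(1) unfolding w_def by metis
    then show ?thesis using cancel semi1 by metis
  qed
  have bij0: "bij \<psi>0" using inj0 surj0 by (metis bijI injI surjI surj_def)
  have "\<exists>m. \<psi>0 ` Dg g = Dg' m" if g: "Dg g \<noteq> {0}" for g
  proof -
    obtain d where d: "d \<in> Dg g" "d \<noteq> 0" using g M.D.zero_in[of g] by blast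
    have "act v1 d \<noteq> 0" using M.act_cancel[OF v1, of d 0] d(2) by auto
    then have "Vg (a + g) \<noteq> {0}" using M.act_comp[OF v1(1) d(1)] by blast
    \<comment> \<open>Degrees in the division algebras are read off from multiples of
      \<open>v1\<close> and \<open>w\<close>; the functionals dual to these vectors return the
      coefficients with degrees lowered by \<open>a\<close> and \<open>h\<close>.\<close>
    then obtain m where m: "\<psi>1 ` Vg (a + g) = Vg' m" using image by blast
    obtain l where l: "M.functional l" "l v1 = 1" "\<And>h x. x \<in> Vg h \<Longrightarrow> l x \<in> Dg (h - a)"
      using M.ex_homogeneous_functional[OF v1] by metis
    obtain l' where l': "N.functional l'" "l' w = 1" "\<And>k x. x \<in> Vg' k \<Longrightarrow> l' x \<in> Dg' (k - h)"
      using N.ex_homogeneous_functional[OF w] by metis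
    have "\<psi>0 d \<in> Dg' (m - h)" if "d \<in> Dg g" for d
    proof -
      have "act' w (\<psi>0 d) \<in> Vg' m"
        using m M.act_comp[OF v1(1) that] unfolding semi1[symmetric] by blast
      then have "l' (act' w (\<psi>0 d)) \<in> Dg' (m - h)" by (rule l'(3))
      then show ?thesis using l'(1,2) by (simp add: N.functional_def)
    qed
    moreover have "e \<in> \<psi>0 ` Dg g" if e: "e \<in> Dg' (m - h)" for e
    proof -
      obtain d where d: "\<psi>0 d = e" using surj0 by blast
      have "\<psi>1 (act v1 d) \<in> \<psi>1 ` Vg (a + g)"
        using N.act_comp[OF w(1) e] m by (simp add: semi1 d)
      then have "act v1 d \<in> Vg (a + g)" using inv1(2) by (metis imageE)
      then have "l (act v1 d) \<in> Dg g" using l(3) by fastforce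
      then have "d \<in> Dg g" using l(1,2) by (simp add: M.functional_def)
      then show ?thesis using d by blast
    qed
    ultimately show ?thesis by blast
  qed
  then have "graded_pair_equivalence sD Dg act Vg sD' Dg' act' Vg' \<psi>0 \<psi>1"
    using eq bij0 add0 mult0 scale0 semi
    by (simp add: graded_pair_equivalence_def graded_algebra_equivalence_def
        graded_space_equivalence_def linear_bij_def)
  moreover have "\<psi> r = \<psi>1 \<circ> r \<circ> inv \<psi>1" if "r \<in> End_D act" for r
    using intertwine[OF that] inv1(1) by (simp add: fun_eq_iff)
  ultimately show thesis using that[of \<psi>0 \<psi>1] by (simp add: induces_def)
qed

section \<open>The freedom in the choice of an inducing pair\<close>

context
  fixes \<psi>0 :: "'d \<Rightarrow> 'e" and \<psi>1 :: "'v \<Rightarrow> 'w"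
  assumes ind: "induces sD Dg act Vg sD' Dg' act' Vg' \<psi>0 \<psi>1 \<psi>"
begin

lemma equivalence0: "graded_space_equivalence UNIV sD Dg UNIV sD' Dg' \<psi>0"
  and bij0: "bij \<psi>0"
  and add0: "\<psi>0 (d + e) = \<psi>0 d + \<psi>0 e"
  and mult0: "\<psi>0 (d * e) = \<psi>0 d * \<psi>0 e"
  and scale0: "\<psi>0 (sD k d) = sD' k (\<psi>0 d)"
  and image0: "Dg g \<noteq> {0} \<Longrightarrow> \<exists>m. \<psi>0 ` Dg g = Dg' m"
  and bij1: "bij \<psi>1"
  and add1: "\<psi>1 (u + v) = \<psi>1 u + \<psi>1 v"
  and scale1: "\<psi>1 (induced_scale sD act k v) = induced_scale sD' act' k (\<psi>1 v)"
  and image1: "Vg b \<noteq> {0} \<Longrightarrow> \<exists>m. \<psi>1 ` Vg b = Vg' m"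
  and semilinear: "\<psi>1 (act v d) = act' (\<psi>1 v) (\<psi>0 d)"
  using ind by (auto simp: induces_def graded_pair_equivalence_def graded_algebra_equivalence_def
      graded_space_equivalence_def linear_bij_def)

lemma intertwines: "r \<in> End_D act \<Longrightarrow> \<psi> r (\<psi>1 v) = \<psi>1 (r v)"
  using ind bij1 by (simp add: induces_def bij_is_inj)

lemma inv1: "\<psi>1 (inv \<psi>1 u) = u" "inv \<psi>1 (\<psi>1 v) = v"
  using bij1 by (simp_all add: bij_is_surj surj_f_inv_f bij_is_inj)

lemma inv0: "\<psi>0 (inv \<psi>0 e) = e" "inv \<psi>0 (\<psi>0 d) = d"
  using bij0 by (simp_all add: bij_is_surj surj_f_inv_f bij_is_inj)

lemma zero0: "\<psi>0 0 = 0" using add0[of 0 0] by simp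

lemma zero1: "\<psi>1 0 = 0" using add1[of 0 0] by simp

lemma nonzero1: "v \<noteq> 0 \<Longrightarrow> \<psi>1 v \<noteq> 0"
  using inv1(2) zero1 by metis

lemma homogeneous1:
  assumes "v \<in> Vg b"
  obtains m where "\<psi>1 v \<in> Vg' m"
proof (cases "v = 0")
  case True
  then show ?thesis using that[of 0] zero1 by simp
next
  case False
  then show ?thesis using image1[of b] assms that by blast
qed

text \<open>The operator \<open>\<psi> r\<close> commutes with the action of \<open>d'\<close>, so
  the twisted map still induces \<open>\<psi>\<close>; the conjugation in \<open>\<psi>0\<close>
  restores semilinearity.\<close>

lemma induces_act_unit:
  assumes "d' \<in> homogeneous_units Dg'"
  shows "induces sD Dg act Vg sD' Dg' act' Vg' (inv (inner_aut d') \<circ> \<psi>0) (\<lambda>v. act' (\<psi>1 v) d') \<psi>"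
proof -
  obtain k where d': "d' \<in> Dg' k" "d' \<noteq> 0" using assms by (auto simp: homogeneous_units_def)
  obtain y where y: "d' * y = 1" "y * d' = 1" "y \<in> Dg' (- k)"
    using N.D.homogeneous_inverse[OF d'] .
  note inner = bij_inner_aut[OF y(1,2)]
  let ?p0 = "inv (inner_aut d') \<circ> \<psi>0" and ?p1 = "\<lambda>v. act' (\<psi>1 v) d'"
  have p0: "?p0 d = y * \<psi>0 d * d'" for d by (simp add: inner)
  have cancel: "d' * (y * e) = e" "e * d' * y = e" "y * (d' * e) = e" "e * y * d' = e" for e
    using y(1,2) by (simp_all add: mult.assoc) (simp_all flip: mult.assoc)
  have act_cancel: "act' (act' u d') y = u" "act' (act' u y) d' = u" for u
    using y(1,2) by (simp_all add: N.act_one flip: N.act_mult)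
  have "bij ?p0" using bij0 inner(1) by (simp add: bij_comp bij_imp_bij_inv)
  moreover have "?p0 (d + e) = ?p0 d + ?p0 e" for d e
    unfolding p0 by (simp add: add0 distrib_left distrib_right)
  moreover have "?p0 (d * e) = ?p0 d * ?p0 e" for d e
    unfolding p0 by (simp add: mult0 mult.assoc cancel)
  moreover have "?p0 (sD k d) = sD' k (?p0 d)" for k d
    unfolding p0 by (simp add: scale0 N.D.scale_mult_left N.D.scale_mult_right)
  moreover have "\<exists>m. ?p0 ` Dg g = Dg' m" if g: "Dg g \<noteq> {0}" for g
  proof -
    obtain m where m: "\<psi>0 ` Dg g = Dg' m" using image0[OF g] by blast
    \<comment> \<open>The degrees of \<open>y\<close> and \<open>d'\<close> cancel, so conjugation
      preserves every component.\<close>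
    have "(\<lambda>e. y * e * d') ` Dg' m = Dg' m"
    proof (intro equalityI subsetI)
      fix x assume "x \<in> (\<lambda>e. y * e * d') ` Dg' m"
      then obtain e where e: "e \<in> Dg' m" "x = y * e * d'" by blast
      then show "x \<in> Dg' m"
        using N.D.mult_comp[OF N.D.mult_comp[OF y(3) e(1)] d'(1)] by simp
    next
      fix x assume x: "x \<in> Dg' m"
      have "d' * x * y \<in> Dg' m" using N.D.mult_comp[OF N.D.mult_comp[OF d'(1) x] y(3)] by simp
      moreover have "x = y * (d' * x * y) * d'" by (simp add: mult.assoc cancel y)
      ultimately show "x \<in> (\<lambda>e. y * e * d') ` Dg' m" by blast
    qed
    moreover have "?p0 ` Dg g = (\<lambda>e. y * e * d') ` (\<psi>0 ` Dg g)"
      unfolding image_image by (rule image_cong[OF refl p0])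
    ultimately show ?thesis using m by auto
  qed
  moreover have bij': "bij ?p1"
    by (rule o_bij[of "\<lambda>u. inv \<psi>1 (act' u y)"]) (auto simp: fun_eq_iff act_cancel inv1)
  moreover have "?p1 (u + v) = ?p1 u + ?p1 v" for u v
    by (simp add: add1 N.act_add_left)
  moreover have "?p1 (induced_scale sD act k v) = induced_scale sD' act' k (?p1 v)" for k v
    unfolding scale1 by (simp add: induced_scale_def N.D.scale_one_central flip: N.act_mult)
  moreover have "\<exists>m. ?p1 ` Vg b = Vg' m" if b: "Vg b \<noteq> {0}" for b
  proof -
    obtain m where m: "\<psi>1 ` Vg b = Vg' m" using image1[OF b] by blast
    have "(\<lambda>u. act' u d') ` Vg' m = Vg' (m + k)"
    proof (intro equalityI subsetI)
      fix x assume x: "x \<in> Vg' (m + k)"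
      have "act' x y \<in> Vg' m" using N.act_comp[OF x y(3)] by simp
      then show "x \<in> (\<lambda>u. act' u d') ` Vg' m" using act_cancel(2)[of x] by (metis imageI)
    qed (use N.act_comp d'(1) in auto)
    moreover have "?p1 ` Vg b = (\<lambda>u. act' u d') ` (\<psi>1 ` Vg b)"
      by (simp only: image_image)
    ultimately show ?thesis using m by auto
  qed
  moreover have "?p1 (act v d) = act' (?p1 v) (?p0 d)" for v d
    unfolding p0 semilinear by (simp add: mult.assoc cancel flip: N.act_mult)
  ultimately have "graded_pair_equivalence sD Dg act Vg sD' Dg' act' Vg' ?p0 ?p1"
    by (simp add: graded_pair_equivalence_def graded_algebra_equivalence_def
        graded_space_equivalence_def linear_bij_def del: comp_apply)
  moreover have "\<psi> r = ?p1 \<circ> r \<circ> inv ?p1" if r: "r \<in> End_D act" for r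
  proof
    fix u
    obtain v where v: "u = ?p1 v" by (rule surjE[OF bij_is_surj[OF bij']])
    have "\<psi> r (?p1 v) = ?p1 (r v)"
      using psi_in[OF r] intertwines[OF r, of v] by (simp add: End_D_def)
    then show "\<psi> r u = (?p1 \<circ> r \<circ> inv ?p1) u"
      unfolding v using inv_f_f[OF bij_is_inj[OF bij'], of v] by simp
  qed
  ultimately show ?thesis by (simp add: induces_def)
qed

end

lemma induces_unique:
  assumes ind: "induces sD Dg act Vg sD' Dg' act' Vg' \<psi>0 \<psi>1 \<psi>"
    and ind': "induces sD Dg act Vg sD' Dg' act' Vg' \<psi>0' \<psi>1' \<psi>"
  shows "\<exists>d'\<in>homogeneous_units Dg'.
    \<psi>0' = inv (inner_aut d') \<circ> \<psi>0 \<and> (\<forall>v. \<psi>1' v = act' (\<psi>1 v) d')"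
proof -
  have "\<psi>1' (inv \<psi>1 (s u)) = s (\<psi>1' (inv \<psi>1 u))" if s: "s \<in> End_D act'" for s u
  proof -
    obtain r where r: "r \<in> End_D act" "\<psi> r = s" using psi_surj[OF s] .
    have "inv \<psi>1 (s u) = r (inv \<psi>1 u)"
      using intertwines[OF ind r(1), of "inv \<psi>1 u"] r(2) inv1[OF ind] by metis
    then show ?thesis using intertwines[OF ind' r(1)] r(2) by simp
  qed
  then obtain d' where "\<And>u. \<psi>1' (inv \<psi>1 u) = act' u d'"
    using N.centralizer_of_End[of "\<lambda>u. \<psi>1' (inv \<psi>1 u)"] by blast
  then have d': "\<psi>1' v = act' (\<psi>1 v) d'" for v using inv1(2)[OF ind] by metis
  obtain v b where v: "v \<in> Vg b" "v \<noteq> 0" using M.ex_homogeneous .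
  define w where "w = \<psi>1 v"
  obtain h where w: "w \<in> Vg' h" "w \<noteq> 0"
    using homogeneous1[OF ind v(1)] nonzero1[OF ind v(2)] unfolding w_def by blast
  obtain m where m: "\<psi>1' v \<in> Vg' m" using homogeneous1[OF ind' v(1)] .
  obtain l where l: "N.functional l" "l w = 1" "\<And>k x. x \<in> Vg' k \<Longrightarrow> l x \<in> Dg' (k - h)"
    using N.ex_homogeneous_functional[OF w] by metis
  \<comment> \<open>Homogeneity of \<open>d'\<close>: it is the coefficient relating two homogeneous
    vectors, recovered by a homogeneous functional.\<close>
  have "l (\<psi>1' v) = d'" using l(1,2) by (simp add: d' N.functional_def flip: w_def)
  then have d'_in: "d' \<in> Dg' (m - h)" using l(3)[OF m] by simp
  have d'_nz: "d' \<noteq> 0" using d'[of v] nonzero1[OF ind' v(2)] by auto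
  obtain y where y: "d' * y = 1" "y * d' = 1" using N.D.homogeneous_invertible[OF d'_in d'_nz] by blast
  have "\<psi>0' d = y * \<psi>0 d * d'" for d
  proof -
    have "act' w (\<psi>0 d * d') = \<psi>1' (act v d)"
      by (simp add: d' semilinear[OF ind] w_def N.act_mult)
    also have "\<dots> = act' w (d' * \<psi>0' d)"
      unfolding semilinear[OF ind'] by (simp add: d' w_def N.act_mult)
    finally have "\<psi>0 d * d' = d' * \<psi>0' d" by (rule N.act_cancel[OF w])
    then have "y * (\<psi>0 d * d') = (y * d') * \<psi>0' d" by (simp add: mult.assoc)
    then show ?thesis using y by (simp add: mult.assoc)
  qed
  then have "\<psi>0' = inv (inner_aut d') \<circ> \<psi>0"
    by (simp add: fun_eq_iff bij_inner_aut(2)[OF y])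
  then show ?thesis using d' d'_in d'_nz by (auto simp: homogeneous_units_def)
qed

section \<open>Conjugate antiautomorphisms and their forms\<close>

context
  fixes \<psi>0 :: "'d \<Rightarrow> 'e" and \<psi>1 :: "'v \<Rightarrow> 'w" and \<phi> \<phi>' \<phi>0 B \<phi>0' B'
  assumes ind: "induces sD Dg act Vg sD' Dg' act' Vg' \<psi>0 \<psi>1 \<psi>"
    and anti: "degree_preserving_antiautomorphism
          (End_D act) (\<circ>) (End_scale sD act) (End_comp act Vg) \<phi>"
    and rep: "represents sD Dg act Vg \<phi>0 B \<phi>"
    and rep': "represents sD' Dg' act' Vg' \<phi>0' B' \<phi>'"
begin

lemma phi_bij: "bij_betw \<phi> (End_D act) (End_D act)"
  using anti by (simp add: degree_preserving_antiautomorphism_def linear_bij_def)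

lemma phi_in: "r \<in> End_D act \<Longrightarrow> \<phi> r \<in> End_D act"
  using phi_bij by (rule bij_betwE[THEN bspec])

lemma adjoint: "r \<in> End_D act \<Longrightarrow> B (r v) w = B v (\<phi> r w)"
  using rep by (simp add: represents_def)

lemma adjoint': "s \<in> End_D act' \<Longrightarrow> B' (s v) w = B' v (\<phi>' s w)"
  using rep' by (simp add: represents_def)

lemma form_left: "B (act v d) w = \<phi>0 d * B v w" "B' (act' v' d') w' = \<phi>0' d' * B' v' w'"
  using rep rep' by (simp_all add: represents_def)

lemma form_right': "B' v (act' w d) = B' v w * d"
  using rep' by (simp add: represents_def)

lemma conj_eq_iff:
  "(\<forall>s\<in>End_D act'. \<psi> (\<phi> (inv_into (End_D act) \<psi> s)) = \<phi>' s) \<longleftrightarrow>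
    (\<forall>r\<in>End_D act. \<psi> (\<phi> r) = \<phi>' (\<psi> r))"
proof -
  have "inv_into (End_D act) \<psi> (\<psi> r) = r" if "r \<in> End_D act" for r
    using psi_bij that by (simp add: bij_betw_inv_into_left)
  then show ?thesis using psi_in psi_surj by metis
qed

text \<open>Moving \<open>r\<close> across \<open>B\<close> and translating by the relation of the
  forms shows that \<open>\<psi> (\<phi> r)\<close> is an adjoint of \<open>\<psi> r\<close> for
  \<open>B'\<close>. So is \<open>\<phi>' (\<psi> r)\<close>, and nondegeneracy leaves only one
  adjoint.\<close>

lemma forms_imp_conj:
  assumes forms: "\<And>v w. B' (\<psi>1 v) (\<psi>1 w) = \<psi>0 (d0 * B v w)" and r: "r \<in> End_D act"
  shows "\<psi> (\<phi> r) = \<phi>' (\<psi> r)"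
proof
  fix u'
  obtain u where u: "u' = \<psi>1 u" using inv1(1)[OF ind] by metis
  have "B' (\<psi>1 v) (\<psi> (\<phi> r) u') = B' (\<psi>1 v) (\<phi>' (\<psi> r) u')" for v
  proof -
    have "B' (\<psi>1 v) (\<psi> (\<phi> r) u') = \<psi>0 (d0 * B (r v) u)"
      unfolding u by (simp add: intertwines[OF ind phi_in[OF r]] forms adjoint[OF r])
    also have "\<dots> = B' (\<psi> r (\<psi>1 v)) u'"
      unfolding u by (simp add: intertwines[OF ind r] forms)
    finally show ?thesis by (simp add: adjoint'[OF psi_in[OF r]])
  qed
  then have "B' v (\<psi> (\<phi> r) u') = B' v (\<phi>' (\<psi> r) u')" for v using inv1(1)[OF ind] by metis
  moreover have "bilinear_over (induced_scale sD' act') sD' B'"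
    using rep' by (simp add: represents_def)
  note bilinear_over_diff[OF this]
  ultimately have "B' v (\<psi> (\<phi> r) u' - \<phi>' (\<psi> r) u') = 0" for v by simp
  then have "\<psi> (\<phi> r) u' - \<phi>' (\<psi> r) u' = 0"
    using rep' unfolding represents_def nondegenerate_def by blast
  then show "\<psi> (\<phi> r) u' = \<phi>' (\<psi> r) u'" by simp
qed

lemma conj_imp_forms:
  assumes conj: "\<And>r. r \<in> End_D act \<Longrightarrow> \<psi> (\<phi> r) = \<phi>' (\<psi> r)"
  shows "\<exists>d0\<in>homogeneous_units Dg. \<forall>v w. B' (\<psi>1 v) (\<psi>1 w) = \<psi>0 (d0 * B v w)"
proof -
  \<comment> \<open>The form \<open>B'\<close> pulled back to V with values in $D$. The conjugation
    hypothesis makes \<open>\<phi>\<close> its adjoint operation, so it is proportional to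
    \<open>B\<close>.\<close>
  define C where "C v w = inv \<psi>0 (B' (\<psi>1 v) (\<psi>1 w))" for v w
  have C: "B' (\<psi>1 v) (\<psi>1 w) = \<psi>0 (C v w)" for v w
    by (simp add: C_def inv0[OF ind])
  have C_right: "C u (act x d) = C u x * d" for u x d
  proof -
    have "\<psi>0 (C u (act x d)) = \<psi>0 (C u x * d)"
      by (simp add: semilinear[OF ind] form_right' mult0[OF ind] flip: C)
    then show ?thesis using inv0(2)[OF ind] by metis
  qed
  have C_adj: "C (r u) x = C u (\<phi> r x)" if r: "r \<in> End_D act" for r u x
    unfolding C_def
    by (simp add: adjoint'[OF psi_in[OF r]] conj[OF r, THEN sym]
        flip: intertwines[OF ind r] intertwines[OF ind phi_in[OF r]])
  obtain v b w a where vw: "v \<in> Vg b" "w \<in> Vg a" and C_eq: "\<And>u x. C u x = C v w * B u x"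
    using M.forms_proportional[of \<phi>0 B \<phi> C, OF rep phi_bij C_right C_adj] by blast
  obtain m where m: "\<psi>1 v \<in> Vg' m" using homogeneous1[OF ind vw(1)] .
  obtain n where n: "\<psi>1 w \<in> Vg' n" using homogeneous1[OF ind vw(2)] .
  \<comment> \<open>The constant \<open>C v w\<close> is the preimage under \<open>\<psi>0\<close>
    of a value of \<open>B'\<close> at homogeneous vectors; an equivalence reflects homogeneity of
    nonzero elements.\<close>
  have "\<exists>k. B' (\<psi>1 v) (\<psi>1 w) \<in> Dg' k"
    using rep' m n unfolding represents_def by blast
  then obtain k where k: "\<psi>0 (C v w) \<in> Dg' k" by (auto simp: C)
  have nz: "C v w \<noteq> 0"
  proof
    assume "C v w = 0"
    then have "B' (\<psi>1 u) (\<psi>1 x) = 0" for u x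
      using C_eq[of u x] by (simp add: C zero0[OF ind])
    then have "B' u x = 0" for u x using inv1(1)[OF ind] by metis
    then have "u = 0" for u :: 'w
      using rep' unfolding represents_def nondegenerate_def by blast
    then show False using N.nontrivial by blast
  qed
  then obtain g where "C v w \<in> Dg g"
    using graded_space_equivalence_homogeneous_preimage[OF M.D.graded_vector_space_axioms
        N.D.graded_vector_space_axioms equivalence0[OF ind] k] by blast
  then have "C v w \<in> homogeneous_units Dg" using nz by (auto simp: homogeneous_units_def)
  moreover have "B' (\<psi>1 u) (\<psi>1 x) = \<psi>0 (C v w * B u x)" for u x
    using C C_eq by metis
  ultimately show ?thesis by blast
qed

lemma forms_imp_inner:
  assumes forms: "\<And>v w. B' (\<psi>1 v) (\<psi>1 w) = \<psi>0 (d0 * B v w)" and d0: "d0 \<in> homogeneous_units Dg"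
  shows "inner_aut d0 \<circ> \<phi>0 = inv \<psi>0 \<circ> \<phi>0' \<circ> \<psi>0"
proof
  fix d
  obtain y where y: "d0 * y = 1" "y * d0 = 1"
    using d0 M.D.homogeneous_invertible unfolding homogeneous_units_def by blast
  obtain w a where w: "w \<in> Vg a" "w \<noteq> 0" using M.ex_homogeneous .
  obtain l where l: "M.functional l" "l w = 1" "\<And>h x. x \<in> Vg h \<Longrightarrow> l x \<in> Dg (h - a)"
    using M.ex_homogeneous_functional[OF w] by metis
  obtain v where "\<And>x. B v x = l x"
    using M.ex_dual_vector[OF rep phi_bij w l] by blast
  then have v: "B v w = 1" using l(2) by simp
  have "\<psi>0 (d0 * \<phi>0 d) = \<phi>0' (\<psi>0 d) * \<psi>0 d0"
    using forms[of "act v d" w] forms[of v w] by (simp add: semilinear[OF ind] form_left v)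
  also have "\<dots> = \<psi>0 (inv \<psi>0 (\<phi>0' (\<psi>0 d)) * d0)"
    by (simp add: mult0[OF ind] inv0[OF ind])
  finally have "d0 * \<phi>0 d = inv \<psi>0 (\<phi>0' (\<psi>0 d)) * d0"
    using inv0(2)[OF ind] by metis
  then have "d0 * \<phi>0 d * y = inv \<psi>0 (\<phi>0' (\<psi>0 d)) * (d0 * y)" by (simp add: mult.assoc)
  then show "(inner_aut d0 \<circ> \<phi>0) d = (inv \<psi>0 \<circ> \<phi>0' \<circ> \<psi>0) d"
    by (simp add: inner_aut_def ring_inverse_eqI[OF y] y)
qed

end

end

theorem theorem5p4:
  fixes sD :: "'f::field \<Rightarrow> 'd::ring_1 \<Rightarrow> 'd"
    and Dg :: "'g::ab_group_add \<Rightarrow> 'd set"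
    and act :: "'v::ab_group_add \<Rightarrow> 'd \<Rightarrow> 'v"
    and Vg :: "'g \<Rightarrow> 'v set"
    and sD' :: "'f \<Rightarrow> 'e::ring_1 \<Rightarrow> 'e"
    and Dg' :: "'h::ab_group_add \<Rightarrow> 'e set"
    and act' :: "'w::ab_group_add \<Rightarrow> 'e \<Rightarrow> 'w"
    and Vg' :: "'h \<Rightarrow> 'w set"
    and \<psi> :: "('v \<Rightarrow> 'v) \<Rightarrow> ('w \<Rightarrow> 'w)"
  assumes "graded_division_algebra sD Dg"
    and "graded_right_module sD Dg act Vg"
    and "finite_rank act"
    and "\<exists>v::'v. v \<noteq> 0"
    and "graded_division_algebra sD' Dg'"
    and "graded_right_module sD' Dg' act' Vg'"
    and "finite_rank act'"
    and "\<exists>w::'w. w \<noteq> 0"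
    and "graded_algebra_equivalence
           (End_D act) (\<circ>) (End_scale sD act) (End_comp act Vg)
           (End_D act') (\<circ>) (End_scale sD' act') (End_comp act' Vg') \<psi>"
  shows "(\<exists>\<psi>0 \<psi>1. induces sD Dg act Vg sD' Dg' act' Vg' \<psi>0 \<psi>1 \<psi>) \<and>
    (\<forall>\<psi>0 \<psi>1. induces sD Dg act Vg sD' Dg' act' Vg' \<psi>0 \<psi>1 \<psi> \<longrightarrow>
      (\<forall>\<psi>0' \<psi>1'. induces sD Dg act Vg sD' Dg' act' Vg' \<psi>0' \<psi>1' \<psi> \<longleftrightarrow>
        (\<exists>d'\<in>homogeneous_units Dg'.
          \<psi>0' = inv (inner_aut d') \<circ> \<psi>0 \<and> (\<forall>v. \<psi>1' v = act' (\<psi>1 v) d'))) \<and>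
      (\<forall>\<phi> \<phi>' \<phi>0 B \<phi>0' B'.
        degree_preserving_antiautomorphism
          (End_D act) (\<circ>) (End_scale sD act) (End_comp act Vg) \<phi> \<and>
        degree_preserving_antiautomorphism
          (End_D act') (\<circ>) (End_scale sD' act') (End_comp act' Vg') \<phi>' \<and>
        represents sD Dg act Vg \<phi>0 B \<phi> \<and>
        represents sD' Dg' act' Vg' \<phi>0' B' \<phi>' \<longrightarrow>
        ((\<forall>s\<in>End_D act'. \<psi> (\<phi> (inv_into (End_D act) \<psi> s)) = \<phi>' s) \<longleftrightarrow>
          (\<exists>d0\<in>homogeneous_units Dg. \<forall>v w. B' (\<psi>1 v) (\<psi>1 w) = \<psi>0 (d0 * B v w))) \<and>
        (\<forall>d0\<in>homogeneous_units Dg. (\<forall>v w. B' (\<psi>1 v) (\<psi>1 w) = \<psi>0 (d0 * B v w)) \<longrightarrow>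
          inner_aut d0 \<circ> \<phi>0 = inv \<psi>0 \<circ> \<phi>0' \<circ> \<psi>0)))"
proof -
  interpret graded_module_pair sD Dg act Vg sD' Dg' act' Vg' \<psi>
    using assms
    by (simp add: graded_module_pair_def graded_module_pair_axioms_def
        graded_division_module_def graded_division_module_axioms_def)
  show ?thesis
  proof (intro conjI allI impI)
    show "\<exists>\<psi>0 \<psi>1. induces sD Dg act Vg sD' Dg' act' Vg' \<psi>0 \<psi>1 \<psi>"
      using ex_induces by metis
  next
    fix \<psi>0 \<psi>1 \<psi>0' \<psi>1'
    assume ind: "induces sD Dg act Vg sD' Dg' act' Vg' \<psi>0 \<psi>1 \<psi>"
    show "induces sD Dg act Vg sD' Dg' act' Vg' \<psi>0' \<psi>1' \<psi> \<longleftrightarrow>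
      (\<exists>d'\<in>homogeneous_units Dg'.
        \<psi>0' = inv (inner_aut d') \<circ> \<psi>0 \<and> (\<forall>v. \<psi>1' v = act' (\<psi>1 v) d'))" (is "?L \<longleftrightarrow> ?R")
    proof
      assume ?L
      then show ?R by (rule induces_unique[OF ind])
    next
      assume ?R
      then obtain d' where d': "d' \<in> homogeneous_units Dg'"
        and eq: "\<psi>0' = inv (inner_aut d') \<circ> \<psi>0" "\<psi>1' = (\<lambda>v. act' (\<psi>1 v) d')"
        by (auto simp: fun_eq_iff)
      show ?L unfolding eq by (rule induces_act_unit[OF ind d'])
    qed
  next
    fix \<psi>0 \<psi>1 \<phi> \<phi>' \<phi>0 B \<phi>0' B'
    assume ind: "induces sD Dg act Vg sD' Dg' act' Vg' \<psi>0 \<psi>1 \<psi>"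
      and *: "degree_preserving_antiautomorphism
          (End_D act) (\<circ>) (End_scale sD act) (End_comp act Vg) \<phi> \<and>
        degree_preserving_antiautomorphism
          (End_D act') (\<circ>) (End_scale sD' act') (End_comp act' Vg') \<phi>' \<and>
        represents sD Dg act Vg \<phi>0 B \<phi> \<and>
        represents sD' Dg' act' Vg' \<phi>0' B' \<phi>'"
    then have hyps: "degree_preserving_antiautomorphism
          (End_D act) (\<circ>) (End_scale sD act) (End_comp act Vg) \<phi>"
        "represents sD Dg act Vg \<phi>0 B \<phi>" "represents sD' Dg' act' Vg' \<phi>0' B' \<phi>'"
      by blast+
    show "(\<forall>s\<in>End_D act'. \<psi> (\<phi> (inv_into (End_D act) \<psi> s)) = \<phi>' s) \<longleftrightarrow>
        (\<exists>d0\<in>homogeneous_units Dg. \<forall>v w. B' (\<psi>1 v) (\<psi>1 w) = \<psi>0 (d0 * B v w))"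
      unfolding conj_eq_iff[OF ind hyps]
      using conj_imp_forms[OF ind hyps] forms_imp_conj[OF ind hyps] by metis
    show "\<forall>d0\<in>homogeneous_units Dg. (\<forall>v w. B' (\<psi>1 v) (\<psi>1 w) = \<psi>0 (d0 * B v w)) \<longrightarrow>
        inner_aut d0 \<circ> \<phi>0 = inv \<psi>0 \<circ> \<phi>0' \<circ> \<psi>0"
      using forms_imp_inner[OF ind hyps] by blast
  qed
qed

end
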